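(* Let $j\ge 2$ be an integer and $\alpha=1-1/j$. Let $U$ be uniformly distributed on $(0,\pi)$ and let $a_{1-1/j}(U)$ be the corresponding Kanter random variable. Let $\beta_1,\dots,\beta_{j-1}$ be independent Beta random variables of the first kind such that $\beta_k$ has the density $$\frac{1}{B\big(k/j+1,\;k/(j(j-1))\big)}\; t^{k/j}(1-t)^{k/(j-1)-k/j-1}\,\mathbf{1}_{(0,1)}(t),\qquad 1\le k\le j-1,$$ where $B(\cdot,\cdot)$ is the Euler Beta function. Then for $\Re(s)>-1/j$, $$\mathbb{E}\left[\frac{1}{[a_{1-1/j}(U)]^s}\right] = j\left[\frac{j^{j}}{(j-1)^{j-1}}\right]^{s-1}\mathbb{E}\big[(\beta_1\cdots\beta_{j-1})^{s-1}\big].$$ When moreover $s\neq 0$, this equality may be written as $$\int_0^{\infty} u^{s-1}\,\mathbb{P}\big(a_{1-1/j}(U)<1/u\big)\,du = j\,\mathbb{E}\left[\left(\frac{j^{j}}{(j-1)^{j-1}}\,V\beta_1\cdots\beta_{j-1}\right)^{s-1}\right],$$ where $V$ is uniformly distributed on $(0,1)$ and independent of $\beta_1,\dots,\beta_{j-1}$.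
   Context: For $0<\alpha<1$ and $u\in(0,\pi)$ put $c_\alpha(u)=\frac{\sin(\alpha u)}{\sin u}$, $b_\alpha(u)=[c_\alpha(u)]^{\alpha}[c_{1-\alpha}(u)]^{1-\alpha}$ and $a_\alpha(u)=[b_\alpha(u)]^{1/(1-\alpha)}$. Kanter's random variable of index $\alpha$ is $a_\alpha(U)$ with $U$ uniform on $(0,\pi)$.
   Formalization: For Re(s) ≤ 0 both sides of the second identity diverge, so there it is proved as an equality of the holomorphic continuations of its two sides from Re(s) > 0 to Re(s) > −1/j, s ≠ 0; for Re(s) > 0 it is proved literally, with absolute convergence. *)

theory Defs
  imports "HOL-Probability.Probability" "HOL-Complex_Analysis.Complex_Analysis"
begin

definition kanter_c :: "real \<Rightarrow> real \<Rightarrow> real" where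
  "kanter_c \<alpha> u = sin (\<alpha> * u) / sin u"

definition kanter_b :: "real \<Rightarrow> real \<Rightarrow> real" where
  "kanter_b \<alpha> u = kanter_c \<alpha> u powr \<alpha> * kanter_c (1 - \<alpha>) u powr (1 - \<alpha>)"

definition kanter_a :: "real \<Rightarrow> real \<Rightarrow> real" where
  "kanter_a \<alpha> u = kanter_b \<alpha> u powr (1 / (1 - \<alpha>))"

definition uniform_density :: "real \<Rightarrow> real \<Rightarrow> real \<Rightarrow> real" where
  "uniform_density a b x = indicator {a<..<b} x / (b - a)"

definition kanter_beta_density :: "nat \<Rightarrow> nat \<Rightarrow> real \<Rightarrow> real" where
  "kanter_beta_density j k t =
     1 / Beta (real k / real j + 1) (real k / (real j * (real j - 1)))
     * t powr (real k / real j)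
     * (1 - t) powr (real k / (real j - 1) - real k / real j - 1)
     * indicator {0<..<1} t"

definition kanter_const :: "nat \<Rightarrow> real" where
  "kanter_const j = real j ^ j / (real j - 1) ^ (j - 1)"

definition tail_integrand :: "'a measure \<Rightarrow> ('a \<Rightarrow> real) \<Rightarrow> complex \<Rightarrow> real \<Rightarrow> complex" where
  "tail_integrand M X s u =
     of_real u powr (s - 1) * of_real (measure M {\<omega> \<in> space M. X \<omega> < 1 / u})"

text \<open>
  The integrals that involve \<open>V\<close> or the tail probability
  converge absolutely exactly when \<open>Re s > 0\<close>. Off that half plane they can only carry information
  through their holomorphic continuation; the predicate below says that \<open>F\<close> is a continuation
  of \<open>f\<close> from \<open>A\<close> to \<open>D\<close>. (It is unique when \<open>D\<close> is open and connected and
  \<open>A\<close> is open and nonempty.)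
\<close>
definition holomorphic_continuation ::
    "(complex \<Rightarrow> complex) \<Rightarrow> (complex \<Rightarrow> complex) \<Rightarrow> complex set \<Rightarrow> complex set \<Rightarrow> bool" where
  "holomorphic_continuation F f A D \<longleftrightarrow>
     A \<subseteq> D \<and> F holomorphic_on D \<and> (\<forall>s\<in>A. F s = f s)"

end

theory Submission
  imports Defs "HOL-Real_Asymp.Real_Asymp"
begin

text \<open>
  Both \<open>X = 1 / a(U)\<close> and \<open>W = \<beta>\<^sub>1 \<cdots> \<beta>\<^sub>j\<^sub>-\<^sub>1\<close> are bounded, so the
  first identity follows for all \<open>s\<close> once it is known for \<open>s = 1, 2, 3, \<dots>\<close>: with
  \<open>C = j\<^sup>j / (j-1)\<^sup>j\<^sup>-\<^sup>1\<close>, the law of \<open>X / C\<close> reweighted by \<open>x \<mapsto> C x / j\<close> and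
  the law of \<open>W\<close> live on \<open>[0,1]\<close> and have the same moments, hence coincide. For integral \<open>s = n\<close> both
  sides equal \<open>(n j choose n)\<close>. On the Beta side this is a telescoping product. On the Kanter
  side \<open>X\<^sup>n\<close> is the value of \<open>(1 + z)\<^sup>n\<^sup>j / z\<^sup>n\<^sup>(\<^sup>j\<^sup>-\<^sup>1\<^sup>)\<close> along a closed curve around \<open>0\<close>
  parametrised by \<open>arg z\<close>, on which this function is real, so the mean picks out a binomial coefficient.

  For \<open>Re s > 0\<close> the second identity is the first one divided by \<open>s\<close>. For \<open>Re s \<le> 0\<close>
  neither of its integrals converges absolutely, and both are \<open>0\<close> by convention.
\<close>

section \<open>Moment determinacy on a bounded interval\<close>

text \<open>On \<open>[-1,1]\<close> every absolute moment is at most 1, so the characteristic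
  function at \<open>t\<close> differs from its Taylor polynomial of degree \<open>n\<close> by at
  most \<open>2 * \<bar>t\<bar>^n / fact n\<close>, which tends to 0. The moments therefore fix the
  characteristic function, and Levy's uniqueness theorem applies.\<close>

lemma real_distribution_eqI_moments:
  fixes \<mu> \<nu> :: "real measure"
  assumes "real_distribution \<mu>" "real_distribution \<nu>"
    and bnd: "AE x in \<mu>. \<bar>x\<bar> \<le> 1" "AE x in \<nu>. \<bar>x\<bar> \<le> 1"
    and mom: "\<And>n::nat. (\<integral>x. x ^ n \<partial>\<mu>) = (\<integral>x. x ^ n \<partial>\<nu>)"
  shows "\<mu> = \<nu>"
proof (rule Levy_uniqueness[OF assms(1,2)], rule ext)
  fix t :: real
  have approx: "integrable \<rho> (\<lambda>x. x ^ n) \<and>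
      cmod (char \<rho> t - (\<Sum>k\<le>n. ((\<i> * t)^k / fact k) * complex_of_real (\<integral>x. x ^ k \<partial>\<rho>)))
        \<le> 2 * \<bar>t\<bar>^n / fact n"
    if "real_distribution \<rho>" and b: "AE x in \<rho>. \<bar>x\<bar> \<le> 1" for \<rho> :: "real measure" and n
  proof -
    interpret real_distribution \<rho> by fact
    have le: "AE x in \<rho>. \<bar>x\<bar> ^ m \<le> 1" for m
      using b by eventually_elim (simp add: power_le_one)
    have int: "integrable \<rho> (\<lambda>x. x ^ m)" for m
      by (rule integrable_const_bound[of _ 1]) (use le[of m] in \<open>auto simp: power_abs\<close>)
    have "expectation (\<lambda>x. \<bar>x\<bar>^n) \<le> expectation (\<lambda>_. 1)"
      by (rule integral_mono_AE) (use int[THEN integrable_abs, of n] le[of n] in \<open>auto simp: power_abs\<close>)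
    hence "(2*\<bar>t\<bar>^n / fact n) * expectation (\<lambda>x. \<bar>x\<bar>^n) \<le> (2*\<bar>t\<bar>^n / fact n) * 1"
      using prob_space by (intro mult_left_mono) auto
    with char_approx1[of n t] int show ?thesis by fastforce
  qed
  have le: "cmod (char \<mu> t - char \<nu> t) \<le> 4 * (inverse (fact n) * \<bar>t\<bar>^n)" for n
  proof -
    \<comment> \<open>By \<open>mom\<close>, one Taylor polynomial approximates both characteristic
      functions.\<close>
    define S where "S = (\<Sum>k\<le>n. ((\<i> * t)^k / fact k) * complex_of_real (\<integral>x. x ^ k \<partial>\<mu>))"
    have "cmod (char \<mu> t - char \<nu> t) \<le> cmod (char \<mu> t - S) + cmod (char \<nu> t - S)"
      by (metis norm_triangle_ineq4 add_diff_cancel_right' diff_diff_eq2 diff_add_cancel)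
    also have "\<dots> \<le> 2 * \<bar>t\<bar>^n / fact n + 2 * \<bar>t\<bar>^n / fact n"
      using approx[OF assms(1) bnd(1), of n] approx[OF assms(2) bnd(2), of n]
      unfolding S_def mom by linarith
    finally show ?thesis by (simp add: field_simps)
  qed
  have lim: "(\<lambda>n. 4 * (inverse (fact n) * \<bar>t\<bar>^n)) \<longlonglongrightarrow> 4 * 0"
    by (intro tendsto_mult tendsto_const summable_LIMSEQ_zero summable_exp)
  have "cmod (char \<mu> t - char \<nu> t) \<le> 4 * 0"
    by (rule LIMSEQ_le_const[OF lim]) (use le in blast)
  thus "char \<mu> t = char \<nu> t" by simp
qed

section \<open>Holomorphy of integrals of exponentials\<close>

text \<open>Around each \<open>z\<close> the integral is a power series: expand
  \<open>exp ((w - z) * Z)\<close> and integrate termwise. With \<open>Z = ln X\<close> this makes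
  the complex moments of a positive \<open>X\<close> holomorphic in the exponent.\<close>

lemma holomorphic_on_integral_exp:
  fixes Z :: "'a \<Rightarrow> real"
  assumes [measurable]: "Z \<in> borel_measurable M"
    and int: "\<And>\<sigma>. a < \<sigma> \<Longrightarrow> integrable M (\<lambda>\<omega>. exp (\<sigma> * Z \<omega>))"
  shows "(\<lambda>s. \<integral>\<omega>. exp (s * complex_of_real (Z \<omega>)) \<partial>M) holomorphic_on {s. a < Re s}"
proof -
  have ball: "\<exists>r>0. (\<lambda>s. \<integral>\<omega>. exp (s * complex_of_real (Z \<omega>)) \<partial>M) holomorphic_on ball z r" 
    if z: "a < Re z" for z
  proof -
    \<comment> \<open>Half the distance to the boundary line, so that \<open>Re z - d\<close> stays
      above \<open>a\<close> for all \<open>d < r\<close>.\<close>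
    define r where "r = (Re z - a) / 2"
    have r: "r > 0" using z by (simp add: r_def)
    define c where "c n = (\<integral>\<omega>. exp (z * complex_of_real (Z \<omega>)) * of_real (Z \<omega>) ^ n / fact n \<partial>M)" for n
    have "(\<lambda>n. c n * (w - z) ^ n) sums (\<integral>\<omega>. exp (w * complex_of_real (Z \<omega>)) \<partial>M)"
      if w: "w \<in> ball z r" for w
    proof -
      define d where "d = cmod (w - z)"
      have d: "0 \<le> d" "d < r" using w by (auto simp: d_def dist_norm norm_minus_commute)
      define f where "f n \<omega> = exp (z * complex_of_real (Z \<omega>)) * (((w - z) * of_real (Z \<omega>)) ^ n /\<^sub>R fact n)" for n \<omega>
      have [measurable]: "f n \<in> borel_measurable M" for n unfolding f_def by measurable
      \<comment> \<open>The series of norms sums to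
        \<open>exp (Re z * Z \<omega>) * exp (d * \<bar>Z \<omega>\<bar>)\<close>. According to the
        sign of \<open>Z \<omega>\<close> this is one of the two summands of \<open>B\<close>, so
        \<open>B\<close> is an integrable majorant of all partial sums.\<close>
      define B where "B \<omega> = exp ((Re z + d) * Z \<omega>) + exp ((Re z - d) * Z \<omega>)" for \<omega>
      have intB: "integrable M B" unfolding B_def
        using d z by (intro Bochner_Integration.integrable_add int) (auto simp: r_def field_simps)
      have nf: "norm (f n \<omega>) = exp (Re z * Z \<omega>) * ((d * \<bar>Z \<omega>\<bar>) ^ n /\<^sub>R fact n)" for n \<omega>
        by (simp add: f_def norm_mult norm_power d_def power_mult_distrib norm_divide)
      have sumsf: "(\<lambda>n. norm (f n \<omega>)) sums (exp (Re z * Z \<omega>) * exp (d * \<bar>Z \<omega>\<bar>))" for \<omega>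
        unfolding nf by (intro sums_mult exp_converges)
      have le: "exp (Re z * Z \<omega>) * exp (d * \<bar>Z \<omega>\<bar>) \<le> B \<omega>" for \<omega>
        by (cases "Z \<omega> \<ge> 0") (auto simp: B_def exp_add [symmetric] algebra_simps)
      have part: "(\<Sum>n<m. norm (f n \<omega>)) \<le> B \<omega>" for m \<omega>
        using sum_le_suminf[OF sums_summable[OF sumsf], of "{..<m}" \<omega>] sums_unique[OF sumsf] le[of \<omega>]
        by simp
      have intf: "integrable M (f n)" for n
      proof (rule Bochner_Integration.integrable_bound[OF intB])
        show "AE \<omega> in M. norm (f n \<omega>) \<le> norm (B \<omega>)"
        proof (rule AE_I2)
          fix \<omega>
          have "norm (f n \<omega>) \<le> (\<Sum>i<Suc n. norm (f i \<omega>))"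
            by (intro member_le_sum) auto
          also have "\<dots> \<le> B \<omega>" by (rule part)
          finally show "norm (f n \<omega>) \<le> norm (B \<omega>)" by simp
        qed
      qed measurable
      have "(\<lambda>n. integral\<^sup>L M (f n)) sums (\<integral>\<omega>. (\<Sum>n. f n \<omega>) \<partial>M)"
      proof (rule sums_integral[OF intf])
        show "AE \<omega> in M. summable (\<lambda>n. norm (f n \<omega>))"
          using sums_summable[OF sumsf] by auto
        show "summable (\<lambda>n. \<integral>\<omega>. norm (f n \<omega>) \<partial>M)"
        proof (rule summableI_nonneg_bounded)
          fix m
          have "(\<Sum>n<m. \<integral>\<omega>. norm (f n \<omega>) \<partial>M) = (\<integral>\<omega>. (\<Sum>n<m. norm (f n \<omega>)) \<partial>M)"
            using intf by (subst Bochner_Integration.integral_sum) auto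
          also have "\<dots> \<le> integral\<^sup>L M B"
            using intf intB part by (intro integral_mono) auto
          finally show "(\<Sum>n<m. \<integral>\<omega>. norm (f n \<omega>) \<partial>M) \<le> integral\<^sup>L M B" .
        qed auto
      qed
      moreover have "(\<Sum>n. f n \<omega>) = exp (w * complex_of_real (Z \<omega>))" for \<omega>
      proof -
        have "f n \<omega> = exp (z * complex_of_real (Z \<omega>)) * (((w - z) * of_real (Z \<omega>)) ^ n /\<^sub>R fact n)" for n
          by (simp add: f_def)
        hence "(\<lambda>n. f n \<omega>) sums (exp (z * complex_of_real (Z \<omega>)) * exp ((w - z) * of_real (Z \<omega>)))"
          by (simp only:) (intro sums_mult exp_converges)
        thus ?thesis by (simp add: sums_iff exp_add[symmetric] algebra_simps)
      qed
      moreover have "integral\<^sup>L M (f n) = c n * (w - z) ^ n" for n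
      proof -
        have "integral\<^sup>L M (f n) = (\<integral>\<omega>. (exp (z * complex_of_real (Z \<omega>)) * of_real (Z \<omega>) ^ n / fact n) * (w - z) ^ n \<partial>M)"
          by (intro Bochner_Integration.integral_cong)
             (simp_all add: f_def scaleR_conv_of_real power_mult_distrib divide_inverse mult_ac)
        thus ?thesis by (simp add: c_def)
      qed
      ultimately show ?thesis by (simp only:)
    qed
    from power_series_holomorphic[OF this] r show ?thesis by blast
  qed
  have "\<exists>f'. ((\<lambda>s. \<integral>\<omega>. exp (s * complex_of_real (Z \<omega>)) \<partial>M) has_field_derivative f') (at z)"
    if "a < Re z" for z
    using ball[OF that] by (meson open_ball centre_in_ball holomorphic_on_open)
  thus ?thesis
    by (simp add: holomorphic_on_open open_halfspace_Re_gt)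
qed

section \<open>Powers near 0 and Mellin transforms of tail probabilities\<close>

lemma
  fixes s :: complex and x :: real
  assumes s: "Re s > 0" and x: "x \<ge> 0"
  shows set_integrable_powr_from_0: "set_integrable lborel {0<..<x} (\<lambda>u. complex_of_real u powr (s - 1))"
    and LINT_powr_from_0: "(LINT u:{0<..<x}|lborel. complex_of_real u powr (s - 1)) = of_real x powr s / s"
    and LINT_norm_powr_from_0: "(LINT u:{0<..<x}|lborel. norm (complex_of_real u powr (s - 1))) = x powr Re s / Re s"
proof -
  have nrm: "norm (complex_of_real u powr (s - 1)) = u powr (Re s - 1)" if "u > 0" for u
    using that by (simp add: norm_powr_real_powr)
  have hi: "((\<lambda>u. u powr (Re s - 1)) has_integral (x powr Re s / Re s)) {0<..<x}"
    using has_integral_powr_from_0[of "Re s - 1" x] s x by (simp add: has_integral_Icc_iff_Ioo)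
  have abs: "(\<lambda>u. u powr (Re s - 1)) absolutely_integrable_on {0<..<x}"
    using hi by (intro nonnegative_absolutely_integrable_1) (auto simp: integrable_on_def)
  have si: "set_integrable lborel {0<..<x} (\<lambda>u. u powr (Re s - 1))"
    using abs unfolding set_integrable_def by (subst (asm) integrable_completion) auto
  show *: "set_integrable lborel {0<..<x} (\<lambda>u. complex_of_real u powr (s - 1))"
    by (rule set_integrable_bound[OF si]) (auto simp: nrm set_borel_measurable_def)
  have "(LINT u:{0<..<x}|lborel. norm (complex_of_real u powr (s - 1))) = (LINT u:{0<..<x}|lborel. u powr (Re s - 1))"
    by (intro set_lebesgue_integral_cong) (auto simp: nrm)
  also have "\<dots> = x powr Re s / Re s"
    using set_borel_integral_eq_integral(2)[OF si] hi by (simp add: integral_unique)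
  finally show "(LINT u:{0<..<x}|lborel. norm (complex_of_real u powr (s - 1))) = x powr Re s / Re s" .
  have "((\<lambda>u. complex_of_real u powr (s - 1)) has_integral (of_real x powr s / s - of_real 0 powr s / s)) {0..x}"
  proof (rule fundamental_theorem_of_calculus_interior[OF x])
    \<comment> \<open>\<open>Re s > 0\<close> makes the antiderivative continuous at 0, where the
      integrand may be unbounded; differentiability is then needed only in the interior.\<close>
    show "continuous_on {0..x} (\<lambda>u. complex_of_real u powr s / s)"
      using s by (intro continuous_intros continuous_on_powr_complex) auto
    show "((\<lambda>u. complex_of_real u powr s / s) has_vector_derivative complex_of_real u powr (s - 1)) (at u)"
      if "u \<in> {0<..<x}" for u
    proof -
      have "((\<lambda>z. z powr s / s) has_field_derivative (complex_of_real u powr (s - 1))) (at (of_real u))"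
        using that s by (auto intro!: derivative_eq_intros simp: complex_nonpos_Reals_iff)
      from has_vector_derivative_real_field[OF this] show ?thesis by (simp add: o_def)
    qed
  qed
  hence "((\<lambda>u. complex_of_real u powr (s - 1)) has_integral (of_real x powr s / s)) {0<..<x}"
    by (simp add: has_integral_Icc_iff_Ioo)
  thus "(LINT u:{0<..<x}|lborel. complex_of_real u powr (s - 1)) = of_real x powr s / s"
    using set_borel_integral_eq_integral(2)[OF *] by (simp add: integral_unique)
qed

text \<open>Near 0 the power dominates \<open>inverse u\<close>, whose integral diverges
  logarithmically.\<close>

lemma not_set_integrable_powr_from_0:
  fixes p x :: real
  assumes p: "p \<le> -1" and x: "0 < x"
  shows "\<not> set_integrable lborel {0<..<x} (\<lambda>u. u powr p)"
proof
  assume int: "set_integrable lborel {0<..<x} (\<lambda>u. u powr p)"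
  \<comment> \<open>Capping at 1 ensures \<open>inverse u \<le> u powr p\<close> on the interval,
    because \<open>p \<le> -1\<close>.\<close>
  define y where "y = min x 1"
  have y: "0 < y" "y \<le> x" "y \<le> 1" using x by (auto simp: y_def)
  have "set_integrable lborel {0<..<y} (\<lambda>u. u powr p)"
    by (rule set_integrable_subset[OF int]) (use y in auto)
  hence int1: "set_integrable lborel {0<..<y} (\<lambda>u. inverse u)"
  proof (rule set_integrable_bound)
    show "AE u in lborel. u \<in> {0<..<y} \<longrightarrow> norm (inverse u) \<le> norm (u powr p)"
    proof (intro AE_I2 impI)
      fix u assume u: "u \<in> {0<..<y}"
      have "inverse u = u powr (-1)" using u by (simp add: powr_minus)
      also have "\<dots> \<le> u powr p" using u y p by (intro powr_mono') auto
      finally show "norm (inverse u) \<le> norm (u powr p)" using u by simp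
    qed
  qed (auto simp: set_borel_measurable_def)
  define I where "I = (LINT u:{0<..<y}|lborel. inverse u)"
  have bound: "ln y - ln \<epsilon> \<le> I" if e: "0 < \<epsilon>" "\<epsilon> < y" for \<epsilon>
  proof -
    have hi: "(inverse has_integral (ln y - ln \<epsilon>)) {\<epsilon>..y}"
      using e by (intro fundamental_theorem_of_calculus)
        (auto intro!: derivative_eq_intros simp: has_real_derivative_iff_has_vector_derivative [symmetric] field_simps)
    have si: "set_integrable lborel {\<epsilon><..<y} inverse"
      by (rule set_integrable_subset[OF int1]) (use e in auto)
    have "ln y - ln \<epsilon> = (LINT u:{\<epsilon><..<y}|lborel. inverse u)"
      using set_borel_integral_eq_integral(2)[OF si] hi by (simp add: integral_unique has_integral_Icc_iff_Ioo)
    also have "\<dots> \<le> I" unfolding I_def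
      using int1 si e unfolding set_lebesgue_integral_def set_integrable_def
      by (intro integral_mono) (auto simp: indicator_def)
    finally show ?thesis .
  qed
  \<comment> \<open>Chosen so that \<open>ln y - ln \<epsilon>\<close> is at least
    \<open>I + 1\<close>, against \<open>bound\<close>; the cap \<open>y / 2\<close> keeps it inside
    the interval.\<close>
  define \<epsilon> where "\<epsilon> = min (y / 2) (exp (ln y - I - 1))"
  have e: "0 < \<epsilon>" "\<epsilon> < y" using y by (auto simp: \<epsilon>_def)
  have "ln \<epsilon> \<le> ln (exp (ln y - I - 1))"
    using e by (subst ln_le_cancel_iff) (auto simp: \<epsilon>_def)
  with bound[OF e] show False by simp
qed

text \<open>Layer-cake formula: integrate \<open>u powr (s - 1)\<close> over the region
  \<open>0 < u < X \<omega>\<close> in both orders. Integrating over \<open>u\<close> first gives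
  \<open>X powr s / s\<close>, integrating over \<open>\<omega>\<close> first gives the tail
  probability. The same computation with norms justifies Fubini.\<close>

lemma (in prob_space)
  fixes X :: "'a \<Rightarrow> real" and s :: complex
  assumes [measurable]: "X \<in> borel_measurable M" and nn: "AE \<omega> in M. X \<omega> > 0"
    and s: "Re s > 0" and int: "integrable M (\<lambda>\<omega>. X \<omega> powr Re s)"
  shows set_integrable_powr_tail: "set_integrable lborel {0<..} (\<lambda>u. of_real u powr (s - 1) * complex_of_real (prob {\<omega> \<in> space M. u < X \<omega>}))"
    and LINT_powr_tail: "(LINT u:{0<..}|lborel. of_real u powr (s - 1) * complex_of_real (prob {\<omega> \<in> space M. u < X \<omega>}))
            = (\<integral>\<omega>. complex_of_real (X \<omega>) powr s \<partial>M) / s"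
proof -
  interpret P: pair_sigma_finite M lborel by standard
  define f where "f \<omega> u = indicator {0<..<X \<omega>} u *\<^sub>R (complex_of_real u powr (s - 1))" for \<omega> u
  have f_eq: "f \<omega> u = (if 0 < u \<and> u < X \<omega> then complex_of_real u powr (s - 1) else 0)" for \<omega> u
    by (simp add: f_def)
  have meas: "case_prod f \<in> borel_measurable (M \<Otimes>\<^sub>M lborel)"
    unfolding f_eq[abs_def] case_prod_unfold by measurable
  have "integrable (M \<Otimes>\<^sub>M lborel) (case_prod f)"
  proof (rule P.Fubini_integrable[OF meas])
    have "(\<integral>u. norm (f \<omega> u) \<partial>lborel) = X \<omega> powr Re s / Re s" if "X \<omega> > 0" for \<omega>
      using LINT_norm_powr_from_0[OF s, of "X \<omega>"] that by (simp add: f_def set_lebesgue_integral_def)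
    hence "AE \<omega> in M. X \<omega> powr Re s / Re s = (\<integral>u. norm (f \<omega> u) \<partial>lborel)"
      using nn by auto
    with int show "integrable M (\<lambda>\<omega>. \<integral>u. norm (case (\<omega>, u) of (a, b) \<Rightarrow> f a b) \<partial>lborel)"
      using meas by (subst integrable_cong_AE[where g = "\<lambda>\<omega>. X \<omega> powr Re s / Re s"]) auto
    show "AE \<omega> in M. integrable lborel (\<lambda>u. case (\<omega>, u) of (a, b) \<Rightarrow> f a b)"
      using nn set_integrable_powr_from_0[OF s] by (auto simp: f_def set_integrable_def)
  qed
  note F = this
  have inner: "(\<integral>\<omega>. f \<omega> u \<partial>M) = indicator {0<..} u *\<^sub>R (of_real u powr (s - 1) * complex_of_real (prob {\<omega> \<in> space M. u < X \<omega>}))" for u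
  proof -
    have "(\<integral>\<omega>. f \<omega> u \<partial>M) = (\<integral>\<omega>. indicator {\<omega> \<in> space M. u < X \<omega>} \<omega> *\<^sub>R (indicator {0<..} u *\<^sub>R (of_real u powr (s - 1) :: complex)) \<partial>M)"
      by (intro Bochner_Integration.integral_cong) (auto simp: f_def indicator_def)
    thus ?thesis by (simp add: scaleR_conv_of_real mult_ac)
  qed
  show "set_integrable lborel {0<..} (\<lambda>u. of_real u powr (s - 1) * complex_of_real (prob {\<omega> \<in> space M. u < X \<omega>}))"
    using P.integrable_snd[OF F] unfolding inner set_integrable_def .
  have "(LINT u:{0<..}|lborel. of_real u powr (s - 1) * complex_of_real (prob {\<omega> \<in> space M. u < X \<omega>}))
      = (\<integral>u. (\<integral>\<omega>. f \<omega> u \<partial>M) \<partial>lborel)"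
    unfolding inner set_lebesgue_integral_def ..
  also have "\<dots> = (\<integral>\<omega>. (\<integral>u. f \<omega> u \<partial>lborel) \<partial>M)"
    by (rule P.Fubini_integral[OF F])
  also have "\<dots> = (\<integral>\<omega>. complex_of_real (X \<omega>) powr s / s \<partial>M)"
  proof (rule integral_cong_AE)
    show "(\<lambda>\<omega>. \<integral>u. f \<omega> u \<partial>lborel) \<in> borel_measurable M"
      using meas by measurable
    show "AE \<omega> in M. (\<integral>u. f \<omega> u \<partial>lborel) = complex_of_real (X \<omega>) powr s / s"
      using nn LINT_powr_from_0[OF s] by (auto simp: f_def set_lebesgue_integral_def)
  qed measurable
  finally show "(LINT u:{0<..}|lborel. of_real u powr (s - 1) * complex_of_real (prob {\<omega> \<in> space M. u < X \<omega>}))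
            = (\<integral>\<omega>. complex_of_real (X \<omega>) powr s \<partial>M) / s" by simp
qed

text \<open>On \<open>(0, c)\<close> the tail probability is at least its positive value at
  \<open>c\<close>, so integrability would pass to \<open>u powr (Re s - 1)\<close>, which is not
  integrable at 0.\<close>

lemma (in prob_space) not_set_integrable_powr_tail:
  fixes X :: "'a \<Rightarrow> real" and s :: complex
  assumes [measurable]: "X \<in> borel_measurable M" and c: "0 < c" "prob {\<omega> \<in> space M. c < X \<omega>} > 0"
    and s: "Re s \<le> 0"
  shows "\<not> set_integrable lborel {0<..} (\<lambda>u. of_real u powr (s - 1) * complex_of_real (prob {\<omega> \<in> space M. u < X \<omega>}))"
proof
  let ?p = "\<lambda>u. prob {\<omega> \<in> space M. u < X \<omega>}"
  assume "set_integrable lborel {0<..} (\<lambda>u. of_real u powr (s - 1) * complex_of_real (?p u))"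
  hence "set_integrable lborel {0<..<c} (\<lambda>u. of_real u powr (s - 1) * complex_of_real (?p u))"
    by (rule set_integrable_subset) auto
  hence "set_integrable lborel {0<..<c} (\<lambda>u. 1 / of_real (?p c) * (of_real u powr (s - 1) * complex_of_real (?p u)))"
    by (rule set_integrable_mult_right)
  hence "set_integrable lborel {0<..<c} (\<lambda>u. u powr (Re s - 1))"
  proof (rule set_integrable_bound)
    show "AE u in lborel. u \<in> {0<..<c} \<longrightarrow> norm (u powr (Re s - 1)) \<le>
            norm (1 / of_real (?p c) * (of_real u powr (s - 1) * complex_of_real (?p u)))"
    proof (intro AE_I2 impI)
      fix u assume u: "u \<in> {0<..<c}"
      have "?p c \<le> ?p u" using u by (intro finite_measure_mono) auto
      thus "norm (u powr (Re s - 1)) \<le> norm (1 / of_real (?p c) * (of_real u powr (s - 1) * complex_of_real (?p u)))"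
        using u c by (simp add: norm_mult norm_divide norm_powr_real_powr field_simps mult_left_mono)
    qed
  qed (auto simp: set_borel_measurable_def)
  with not_set_integrable_powr_from_0[of "Re s - 1" c] s c show False by simp
qed

section \<open>The reciprocal Kanter function: bounds and integer moments\<close>

text \<open>On \<open>(0, pi)\<close> this is \<open>1 / kanter_a (1 - 1 / real j) u\<close>. The
  outer exponent is \<open>1 / (1 - \<alpha>) = j\<close>, which clears the fractional exponents and
  leaves natural powers only.\<close>

definition kanter_recip :: "nat \<Rightarrow> real \<Rightarrow> real" where
  "kanter_recip j u = sin u ^ j / (sin ((1 - 1 / real j) * u) ^ (j - 1) * sin (u / real j))"

lemma measurable_kanter_recip [measurable]: "kanter_recip j \<in> borel_measurable borel"
  unfolding kanter_recip_def by measurable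

lemma
  assumes "j \<ge> 2" "0 < u" "u < pi"
  shows sin_kanter_pos: "sin ((1 - 1 / real j) * u) > 0" "sin (u / real j) > 0"
    and kanter_recip_pos: "kanter_recip j u > 0"
proof -
  have "(1 - 1 / real j) * u < pi" "u / real j < pi"
  proof -
    have "u * 1 \<le> u * real j" using assms by (intro mult_left_mono) auto
    hence "0 < u / real j" "u / real j \<le> u" using assms by (auto simp: pos_divide_le_eq)
    moreover have "(1 - 1 / real j) * u = u - u / real j" by (simp add: left_diff_distrib)
    ultimately show "(1 - 1 / real j) * u < pi" "u / real j < pi"
      using assms by linarith+
  qed
  thus "sin ((1 - 1 / real j) * u) > 0" "sin (u / real j) > 0"
    using assms by (auto intro!: sin_gt_zero mult_pos_pos)
  moreover have "sin u > 0" using assms by (simp add: sin_gt_zero)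
  ultimately show "kanter_recip j u > 0"
    by (simp add: kanter_recip_def)
qed

lemma kanter_a_eq:
  assumes j: "j \<ge> 2" and u: "0 < u" "u < pi"
  shows "kanter_a (1 - 1 / real j) u = 1 / kanter_recip j u"
proof -
  let ?x = "sin ((1 - 1 / real j) * u)" and ?y = "sin (u / real j)" and ?s = "sin u"
  have s: "?s > 0" using u by (simp add: sin_gt_zero)
  note pos = sin_kanter_pos[OF assms]
  have "kanter_a (1 - 1 / real j) u = ((?x / ?s) powr (1 - 1 / real j) * (?y / ?s) powr (1 / real j)) powr real j"
    by (simp add: kanter_a_def kanter_b_def kanter_c_def)
  also have "\<dots> = (?x / ?s) powr (real j - 1) * (?y / ?s)"
    using pos s j by (simp add: powr_mult powr_powr left_diff_distrib)
  also have "real j - 1 = real (j - 1)" using j by simp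
  also have "(?x / ?s) powr real (j - 1) * (?y / ?s) = (?x / ?s) ^ (j - 1) * (?y / ?s)"
    using pos s by (simp add: powr_realpow)
  also have "\<dots> = 1 / kanter_recip j u"
  proof -
    have "?s ^ j = ?s ^ (j - 1) * ?s" using j by (metis power_minus_mult pos2 less_le_trans)
    thus ?thesis by (simp add: kanter_recip_def power_divide)
  qed
  finally show ?thesis .
qed

text \<open>Concavity of sine on \<open>[0, pi]\<close>, between the points 0 and
  \<open>u\<close>.\<close>

lemma sin_mult_ge:
  assumes "0 \<le> c" "c \<le> 1" "0 \<le> u" "u \<le> pi"
  shows "c * sin u \<le> sin (c * u)"
proof -
  have "convex_on {0..pi} (\<lambda>x. - sin x)"
    by (rule f''_ge0_imp_convex[where f' = "\<lambda>x. - cos x" and f'' = sin])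
       (auto intro!: derivative_eq_intros sin_ge_zero)
  from convex_onD[OF this, of c 0 u] assms show ?thesis by simp
qed

text \<open>Each quotient \<open>sin u / sin (c * u)\<close> is at most \<open>1 / c\<close> by
  concavity; taking \<open>j - 1\<close> factors with \<open>c = 1 - 1/j\<close> and one with
  \<open>c = 1/j\<close> produces the constant. This puts
  \<open>kanter_recip j u / kanter_const j\<close> into \<open>(0, 1]\<close>, as moment determinacy
  requires.\<close>

lemma kanter_recip_le_const:
  assumes j: "j \<ge> 2" and u: "0 < u" "u < pi"
  shows "kanter_recip j u \<le> kanter_const j"
proof -
  let ?a = "1 - 1 / real j"
  have s: "sin u > 0" using u by (simp add: sin_gt_zero)
  note pos = sin_kanter_pos[OF assms]
  have a: "?a > 0" using j by simp
  have 1: "sin u / sin (?a * u) \<le> 1 / ?a"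
    using sin_mult_ge[of ?a u] a u pos by (simp add: field_simps)
  have 2: "sin u / sin (u / real j) \<le> real j"
    using sin_mult_ge[of "1 / real j" u] j u pos by (simp add: field_simps)
  have pw: "x ^ j = x ^ (j - 1) * x" for x :: real using j by (metis power_minus_mult pos2 less_le_trans)
  have "kanter_recip j u = (sin u / sin (?a * u)) ^ (j - 1) * (sin u / sin (u / real j))"
    by (simp add: kanter_recip_def pw[of "sin u"] power_divide)
  also have "\<dots> \<le> (1 / ?a) ^ (j - 1) * real j"
    using 1 2 s pos a by (intro mult_mono power_mono) auto
  also have "1 / ?a = real j / (real j - 1)" using j by (simp add: field_simps)
  also have "\<dots> ^ (j - 1) * real j = kanter_const j"
    by (simp add: kanter_const_def pw[of "real j"] power_divide)
  finally show ?thesis .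
qed

text \<open>
  The curve \<open>z(u) = sin(\<alpha>u)/sin((1-\<alpha>)u) \<cdot> cis u\<close> with \<open>\<alpha> = 1-1/j\<close>
  satisfies \<open>1 + z(u) = sin u/sin((1-\<alpha>)u) \<cdot> cis(\<alpha>u)\<close> by the law of sines, so
  \<open>(1 + z)\<^sup>j / z\<^sup>j\<^sup>-\<^sup>1\<close> is real along it.
\<close>
lemma kanter_curve:
  assumes j: "j \<ge> 2" and u: "0 < u" "u < pi"
  defines "\<rho> \<equiv> sin ((1 - 1 / real j) * u) / sin (u / real j)"
  shows "(\<Sum>k\<le>n*j. of_nat (n*j choose k) * (of_real \<rho> * cis u) powi (int k - int (n*(j-1))))
           = of_real (kanter_recip j u ^ n)"
proof -
  let ?x = "sin ((1 - 1 / real j) * u)" and ?y = "sin (u / real j)" and ?s = "sin u"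
  define z where "z = complex_of_real \<rho> * cis u"
  note pos = sin_kanter_pos[OF j u]
  have z0: "z \<noteq> 0" using pos by (simp add: z_def \<rho>_def)
  have powi: "z powi (int k - int m) = z ^ k / z ^ m" for k m
    using z0 by (simp add: power_int_diff)
  have uj: "u / real j = u - (1 - 1 / real j) * u" using j by (simp add: field_simps)
  \<comment> \<open>The real part of the equation \<open>z1\<close> below, multiplied by
    \<open>?y\<close>.\<close>
  have key: "?y + ?x * cos u = ?s * cos ((1 - 1 / real j) * u)"
    unfolding uj sin_diff by simp
  have z1: "1 + z = of_real (?s / ?y) * cis ((1 - 1 / real j) * u)"
    using pos key by (auto simp: complex_eq_iff z_def \<rho>_def field_simps)
  \<comment> \<open>Numerator and denominator thus have equal phases: \<open>n * j\<close> times the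
    argument \<open>(1 - 1/j) * u\<close> of \<open>1 + z\<close> is \<open>n * (j - 1)\<close>
    times the argument \<open>u\<close> of \<open>z\<close>.\<close>
  have m: "real (n * (j - 1)) = real (n * j) * (1 - 1 / real j)"
    using j by (simp add: field_simps)
  have "(\<Sum>k\<le>n*j. of_nat (n*j choose k) * z powi (int k - int (n*(j-1))))
          = (\<Sum>k\<le>n*j. of_nat (n*j choose k) * z ^ k) / z ^ (n*(j-1))"
    unfolding sum_divide_distrib
    by (simp only: powi times_divide_eq_right)
  also have "(\<Sum>k\<le>n*j. of_nat (n*j choose k) * z ^ k) = (1 + z) ^ (n*j)"
    using binomial_ring[of z 1 "n * j"] by (simp add: add.commute)
  also have "\<dots> = of_real ((?s / ?y) ^ (n*j)) * cis (real (n * j) * ((1 - 1 / real j) * u))"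
    by (simp only: z1 power_mult_distrib Complex.DeMoivre of_real_power)
  also have "real (n * j) * ((1 - 1 / real j) * u) = real (n * (j - 1)) * u"
    unfolding m by simp
  also have "z ^ (n*(j-1)) = of_real (\<rho> ^ (n*(j-1))) * cis (real (n * (j - 1)) * u)"
    by (simp only: z_def power_mult_distrib Complex.DeMoivre of_real_power)
  also have "of_real ((?s / ?y) ^ (n*j)) * cis (real (n * (j - 1)) * u) / \<dots>
      = of_real ((?s / ?y) ^ (n*j) / \<rho> ^ (n*(j-1)))" by simp
  also have "(?s / ?y) ^ (n*j) / \<rho> ^ (n*(j-1)) = ((?s / ?y) ^ j / \<rho> ^ (j-1)) ^ n"
    by (simp only: power_divide power_mult mult.commute[of n])
  also have "(?s / ?y) ^ j / \<rho> ^ (j-1) = kanter_recip j u"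
  proof -
    have "?y ^ j = ?y ^ (j - 1) * ?y" using j by (metis power_minus_mult pos2 less_le_trans)
    thus ?thesis using pos by (simp add: kanter_recip_def \<rho>_def power_divide)
  qed
  finally show ?thesis unfolding z_def .
qed

text \<open>At both ends the curve of \<open>kanter_curve\<close> approaches the real axis, at
  \<open>j - 1\<close> and at \<open>-1\<close>. Hence the imaginary parts of the terms with nonzero
  exponent in the antiderivative vanish there, and only the constant term of the Laurent polynomial
  contributes, namely its coefficient times \<open>pi\<close>.\<close>

lemma kanter_recip_moment:
  assumes j: "j \<ge> 2"
  shows "set_integrable lborel {0<..<pi} (\<lambda>u. kanter_recip j u ^ n)"
    and "(LINT u:{0<..<pi}|lborel. kanter_recip j u ^ n) = pi * real (n * j choose n)"
proof -
  let ?a = "1 - 1 / real j"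
  define N m where "N = n * j" and "m = n * (j - 1)"
  define \<rho> where "\<rho> u = sin (?a * u) / sin (u / real j)" for u :: real
  define p where "p k = int k - int m" for k
  \<comment> \<open>Since \<open>(1 + z)\<^sup>N / z\<^sup>m\<close> is real on the curve and \<open>Im (dz / z) = du\<close>, its antiderivative
    in \<open>u\<close> is the imaginary part of its antiderivative with respect to \<open>dz / z\<close>.\<close>
  define G where "G u = (\<Sum>k\<in>{..N}-{m}. real (N choose k) * (\<rho> u powi p k * sin (p k * u) / p k)) + real (N choose m) * u" for u :: real
  have mN: "m \<le> N" "N - m = n" using j by (auto simp: m_def N_def algebra_simps diff_mult_distrib2)
  have p0: "p k \<noteq> 0" if "k \<noteq> m" for k using that by (simp add: p_def)
  have a: "?a > 0" using j by simp
  have deriv: "(G has_real_derivative kanter_recip j u ^ n) (at u)" if u: "0 < u" "u < pi" for u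
  proof -
    note pos = sin_kanter_pos[OF j u]
    have r0: "\<rho> u > 0" using pos by (simp add: \<rho>_def)
    define d where "d = (?a * cos (?a * u) * sin (u / real j) - sin (?a * u) * (cos (u / real j) / real j)) / sin (u / real j) ^ 2"
    have dr: "(\<rho> has_real_derivative d) (at u)"
      unfolding \<rho>_def[abs_def] d_def using pos
      by (auto intro!: derivative_eq_intros simp: power2_eq_square field_simps)
    \<comment> \<open>The derivative of the \<open>k\<close>-th summand of \<open>G\<close> after
      cancelling \<open>p k\<close>. In this form it also makes sense at
      \<open>k = m\<close>.\<close>
    define T where "T k = real (N choose k) * (\<rho> u powi (p k - 1) * d * sin (p k * u) + \<rho> u powi p k * cos (p k * u))" for k
    have "((\<lambda>u. real (N choose k) * (\<rho> u powi p k * sin (p k * u) / p k)) has_real_derivative T k) (at u)"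
      if "k \<noteq> m" for k
    proof -
      have "((\<lambda>u. \<rho> u powi p k * sin (p k * u)) has_real_derivative
          p k * (\<rho> u powi (p k - 1) * d * sin (p k * u) + \<rho> u powi p k * cos (p k * u))) (at u)"
        using r0 by (auto intro!: derivative_eq_intros dr simp: algebra_simps)
      from DERIV_cmult[OF DERIV_cdivide[OF this, of "p k"], of "real (N choose k)"] p0[OF that]
      show ?thesis by (simp add: T_def)
    qed
    hence "(G has_real_derivative (\<Sum>k\<in>{..N}-{m}. T k) + real (N choose m) * 1) (at u)"
      unfolding G_def[abs_def] by (intro DERIV_add DERIV_sum DERIV_cmult DERIV_ident) auto
    hence "(G has_real_derivative (\<Sum>k\<in>{..N}-{m}. T k) + real (N choose m)) (at u)" by simp
    \<comment> \<open>At \<open>k = m\<close> the exponent \<open>p k\<close> is 0, so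
      \<open>T m\<close> is exactly the binomial coefficient coming from the linear term of
      \<open>G\<close>.\<close>
    moreover have "(\<Sum>k\<in>{..N}-{m}. T k) + real (N choose m) = (\<Sum>k\<le>N. T k)"
      using mN by (subst sum.remove[of _ m]) (auto simp: T_def p_def)
    moreover have "(\<Sum>k\<le>N. T k) = kanter_recip j u ^ n"
    proof -
      have cv: "(\<Sum>k\<le>N. of_nat (N choose k) * (of_real (\<rho> u) * cis u) powi p k) = complex_of_real (kanter_recip j u ^ n)"
        using kanter_curve[OF j u, of n] by (simp only: N_def m_def p_def \<rho>_def)
      have pw: "(of_real (\<rho> u) * cis u) powi q = of_real (\<rho> u powi q) * cis (q * u)" for q
        by (simp add: power_int_mult_distrib cis_power_int)
      have re: "(\<Sum>k\<le>N. real (N choose k) * (\<rho> u powi p k * cos (p k * u))) = kanter_recip j u ^ n"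
        using arg_cong[OF cv, of Re] unfolding pw by (simp del: of_real_power_int)
      have im: "(\<Sum>k\<le>N. real (N choose k) * (\<rho> u powi p k * sin (p k * u))) = 0"
        using arg_cong[OF cv, of Im] unfolding pw by (simp del: of_real_power_int)
      \<comment> \<open>The variation \<open>d\<close> of the modulus enters only as a multiple of
        the imaginary parts. These sum to 0 by \<open>im\<close>, so only the real parts
        remain.\<close>
      have "T k = real (N choose k) * (\<rho> u powi p k * sin (p k * u)) * (d / \<rho> u)
           + real (N choose k) * (\<rho> u powi p k * cos (p k * u))" for k
        using r0 by (simp add: T_def power_int_diff field_simps)
      hence "(\<Sum>k\<le>N. T k) = (\<Sum>k\<le>N. real (N choose k) * (\<rho> u powi p k * sin (p k * u))) * (d / \<rho> u)
           + (\<Sum>k\<le>N. real (N choose k) * (\<rho> u powi p k * cos (p k * u)))"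
        by (simp only: sum.distrib sum_distrib_right)
      thus ?thesis unfolding re im by simp
    qed
    ultimately show ?thesis by simp
  qed
  have lim0: "(G \<longlongrightarrow> 0) (at_right 0)"
  proof -
    \<comment> \<open>A quotient of type 0/0 at the left end; the limit is
      \<open>(1 - 1/j) / (1/j)\<close>.\<close>
    have "((\<lambda>u. sin (?a * u) / sin (u / real j)) \<longlongrightarrow> real j - 1) (at_right 0)"
      using j by real_asymp (simp add: field_simps)
    hence r: "(\<rho> \<longlongrightarrow> real j - 1) (at_right 0)" unfolding \<rho>_def[abs_def] .
    have sl: "((\<lambda>u. sin (c * u)) \<longlongrightarrow> 0) (at_right 0)" for c :: real
      by (auto intro!: tendsto_eq_intros)
    have "(G \<longlongrightarrow> (\<Sum>k\<in>{..N}-{m}. real (N choose k) * ((real j - 1) powi p k * sin (p k * 0) / p k)) + real (N choose m) * 0) (at_right 0)"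
      unfolding G_def[abs_def] using j p0 by (intro tendsto_add tendsto_sum tendsto_mult tendsto_divide tendsto_power_int r tendsto_const tendsto_ident_at) (auto intro: sl)
    thus ?thesis by simp
  qed
  have limpi: "(G \<longlongrightarrow> pi * real (N choose m)) (at_left pi)"
  proof -
    have sj: "sin (pi / real j) > 0" using j by (intro sin_gt_zero) (auto simp: field_simps)
    have "?a * pi = pi - pi / real j" by (simp add: algebra_simps)
    \<comment> \<open>Since \<open>sin (pi - x) = sin x\<close>, the modulus is 1 at the right end.
      Here \<open>\<rho>\<close> is continuous, so \<open>G\<close> can simply be evaluated at
      \<open>pi\<close>.\<close>
    hence r1: "\<rho> pi = 1" using sj by (simp add: \<rho>_def)
    have "isCont \<rho> pi" unfolding \<rho>_def[abs_def] using sj j by (intro continuous_intros) auto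
    hence "isCont G pi" unfolding G_def[abs_def] using r1 p0 by (intro continuous_intros) auto
    hence "(G \<longlongrightarrow> G pi) (at_left pi)"
      by (simp add: isCont_def filterlim_at_split)
    moreover have "G pi = pi * real (N choose m)"
      by (simp add: G_def sin_int_times_real mult.commute)
    ultimately show ?thesis by simp
  qed
  have cont: "isCont (\<lambda>u. kanter_recip j u ^ n) u" if u: "0 < u" "u < pi" for u
    using sin_kanter_pos[OF j u] j unfolding kanter_recip_def by (intro continuous_intros) auto
  have nn: "kanter_recip j u ^ n \<ge> 0" if u: "0 < u" "u < pi" for u
    using kanter_recip_pos[OF j u] by simp
  \<comment> \<open>For a nonnegative integrand, one-sided limits of the antiderivative yield
    integrability on the open interval as well as the value.\<close>
  note FTC = interval_integral_FTC_nonneg[of 0 "ereal pi" G "\<lambda>u. kanter_recip j u ^ n" 0 "pi * real (N choose m)"]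
  have 1: "set_integrable lborel (einterval 0 (ereal pi)) (\<lambda>u. kanter_recip j u ^ n)"
    by (rule FTC(1)) (use deriv cont nn lim0 limpi in
       \<open>auto simp: ereal_tendsto_simps zero_ereal_def intro!: AE_I2\<close>)
  have 2: "(LBINT u=0..pi. kanter_recip j u ^ n) = pi * real (N choose m) - 0"
    by (rule FTC(2)) (use deriv cont nn lim0 limpi in
       \<open>auto simp: ereal_tendsto_simps zero_ereal_def intro!: AE_I2\<close>)
  have ei: "einterval 0 (ereal pi) = {0<..<pi}"
    by (auto simp: einterval_def zero_ereal_def)
  show "set_integrable lborel {0<..<pi} (\<lambda>u. kanter_recip j u ^ n)"
    using 1 unfolding ei .
  have "N choose m = n * j choose n"
    using binomial_symmetric[OF mN(1)] mN(2) by (simp add: N_def)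
  thus "(LINT u:{0<..<pi}|lborel. kanter_recip j u ^ n) = pi * real (n * j choose n)"
    using 2 by (simp add: interval_lebesgue_integral_def ei)
qed

section \<open>Moments of the Beta variables and their product\<close>

lemma kanter_beta_density_nonneg:
  assumes "j \<ge> 2" "k \<ge> 1"
  shows "kanter_beta_density j k t \<ge> 0"
proof -
  have "Beta (real k / real j + 1) (real k / (real j * (real j - 1))) > 0"
    using assms by (auto simp: Beta_def intro!: divide_pos_pos mult_pos_pos Gamma_real_pos add_pos_pos)
  thus ?thesis by (simp add: kanter_beta_density_def)
qed

text \<open>For \<open>p > - 1 - k/j\<close> this is the \<open>p\<close>-th moment of the
  \<open>k\<close>-th Beta variable: the factor \<open>t powr p\<close> shifts the first Beta
  parameter by \<open>p\<close>.\<close>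

definition kanter_beta_moment :: "nat \<Rightarrow> nat \<Rightarrow> real \<Rightarrow> real" where
  "kanter_beta_moment j k p =
     Beta (real k / real j + 1 + p) (real k / (real j * (real j - 1))) /
     Beta (real k / real j + 1) (real k / (real j * (real j - 1)))"

lemma
  fixes X :: "'a \<Rightarrow> real"
  assumes j: "j \<ge> 2" "k \<ge> 1"
    and X: "distributed M lborel X (\<lambda>t. ennreal (kanter_beta_density j k t))"
  shows AE_kanter_beta: "AE \<omega> in M. 0 < X \<omega> \<and> X \<omega> < 1"
    and integrable_kanter_beta_powr: "p > - 1 - real k / real j \<Longrightarrow> integrable M (\<lambda>\<omega>. X \<omega> powr p)"
    and integral_kanter_beta_powr: "p > - 1 - real k / real j \<Longrightarrow> (\<integral>\<omega>. X \<omega> powr p \<partial>M) = kanter_beta_moment j k p"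
proof -
  have meas: "kanter_beta_density j k \<in> borel_measurable borel"
    unfolding kanter_beta_density_def[abs_def] by measurable
  have [measurable]: "X \<in> borel_measurable M"
    using distributed_measurable[OF X] by simp
  have "AE x in density lborel (\<lambda>t. ennreal (kanter_beta_density j k t)). 0 < x \<and> x < 1"
    using meas by (subst AE_density) (auto simp: kanter_beta_density_def indicator_def)
  hence "AE x in distr M lborel X. 0 < x \<and> x < 1"
    unfolding distributed_distr_eq_density[OF X] .
  thus "AE \<omega> in M. 0 < X \<omega> \<and> X \<omega> < 1"
    by (subst (asm) AE_distr_iff) auto
  define a c where "a = real k / real j + 1 + p" and "c = real k / (real j * (real j - 1))"
  define B where "B = Beta (real k / real j + 1) c"
  assume p: "p > - 1 - real k / real j"
  have a: "a > 0" using p by (simp add: a_def)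
  have c: "c > 0" using j by (simp add: c_def)
  \<comment> \<open>Identifies the exponent of \<open>1 - t\<close> in the density as
    \<open>c - 1\<close>, with \<open>c\<close> the second Beta parameter.\<close>
  have c_eq: "real k / (real j - 1) - real k / real j = c"
    using j by (simp add: c_def field_simps)
  have eq: "kanter_beta_density j k t * t powr p = (1 / B) * (indicator {0<..<1} t * (t powr (a - 1) * (1 - t) powr (c - 1)))" for t
    by (auto simp: kanter_beta_density_def c_eq B_def a_def c_def powr_add indicator_def)
  have si: "set_integrable lborel {0<..<1} (\<lambda>t. t powr (a - 1) * (1 - t) powr (c - 1))"
    by (rule set_integrable_subset[OF integrable_Beta[OF a c]]) auto
  have "integrable lborel (\<lambda>t. kanter_beta_density j k t * t powr p)"
    unfolding eq using si by (intro integrable_mult_right) (simp add: set_integrable_def)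
  thus "integrable M (\<lambda>\<omega>. X \<omega> powr p)"
    using kanter_beta_density_nonneg[OF j] by (subst (asm) distributed_integrable[OF X]) auto
  have "(\<integral>\<omega>. X \<omega> powr p \<partial>M) = (\<integral>t. kanter_beta_density j k t * t powr p \<partial>lborel)"
    using kanter_beta_density_nonneg[OF j] by (subst distributed_integral[OF X, symmetric]) auto
  also have "\<dots> = (1 / B) * (LINT t:{0<..<1}|lborel. t powr (a - 1) * (1 - t) powr (c - 1))"
    unfolding eq by (simp add: set_lebesgue_integral_def)
  also have "(LINT t:{0<..<1}|lborel. t powr (a - 1) * (1 - t) powr (c - 1)) = Beta a c"
    using set_borel_integral_eq_integral(2)[OF si] has_integral_Beta_real[OF a c]
    by (simp add: integral_unique has_integral_Icc_iff_Ioo)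
  finally show "(\<integral>\<omega>. X \<omega> powr p \<partial>M) = kanter_beta_moment j k p"
    by (simp add: kanter_beta_moment_def B_def a_def c_def)
qed

text \<open>The recurrence \<open>Beta (a + 1) c = Beta a c * (a / (a + c))\<close>, with
  \<open>a\<close> and \<open>a + c\<close> written over the denominators \<open>j\<close> and
  \<open>j - 1\<close> so that the numerators become consecutive integers as \<open>k\<close>
  varies.\<close>

lemma kanter_beta_moment_Suc:
  assumes j: "j \<ge> 2" "k \<ge> 1"
  shows "kanter_beta_moment j k (real (Suc n)) =
    kanter_beta_moment j k (real n) * ((real (Suc n * j + k) / real j) / (real (Suc n * (j - 1) + k) / real (j - 1)))"
proof -
  define c where "c = real k / (real j * (real j - 1))"
  define a where "a = real k / real j + 1 + real n"
  have "real k / real j \<ge> 0" by simp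
  hence pos: "a > 0" "c > 0" using j unfolding a_def c_def by (linarith, simp)
  hence "a \<notin> \<int>\<^sub>\<le>\<^sub>0" "a + c \<notin> \<int>\<^sub>\<le>\<^sub>0" by (auto dest: nonpos_Ints_nonpos)
  have "(a + c) * Beta (a + 1) c = a * Beta a c"
    using pos \<open>a \<notin> _\<close> \<open>a + c \<notin> _\<close> by (intro Beta_plus1_left) 
  hence B: "Beta (a + 1) c = Beta a c * (a / (a + c))"
    using pos by (simp add: field_simps)
  have a: "a = real (Suc n * j + k) / real j"
    using j by (simp add: a_def field_simps)
  have ac: "a + c = real (Suc n * (j - 1) + k) / real (j - 1)"
  proof -
    have "real k / real j + c = real k / (real j - 1)"
      using j by (simp add: c_def field_simps)
    thus ?thesis using j by (simp add: a_def field_simps of_nat_diff)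
  qed
  have "kanter_beta_moment j k (real (Suc n)) = Beta (a + 1) c / Beta (real k / real j + 1) c"
    by (simp add: kanter_beta_moment_def a_def c_def add_ac)
  also have "\<dots> = kanter_beta_moment j k (real n) * (a / (a + c))"
    unfolding B by (simp add: kanter_beta_moment_def a_def c_def)
  finally show ?thesis unfolding ac by (simp only: a)
qed

text \<open>Induction on \<open>n\<close>: multiplying the recurrence over \<open>k\<close> gives a
  quotient of two runs of consecutive integers, which is the ratio of successive binomial
  coefficients up to powers of \<open>j\<close> and \<open>j - 1\<close> that
  \<open>kanter_const j\<close> absorbs. The index on the right is \<open>n + 1\<close> because the
  Kanter law is reweighted by one factor of its variable.\<close>

lemma prod_kanter_beta_moment:
  assumes j: "j \<ge> 2"
  shows "real j * kanter_const j ^ n * (\<Prod>k\<in>{1..j-1}. kanter_beta_moment j k (real n)) = real (Suc n * j choose Suc n)"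
proof (induction n)
  case 0
  have "Beta (real k / real j + 1) (real k / (real j * (real j - 1))) > 0" if "k \<ge> 1" for k
    using that j by (auto simp: Beta_def intro!: divide_pos_pos mult_pos_pos Gamma_real_pos add_pos_pos)
  hence "(\<Prod>k\<in>{1..j-1}. kanter_beta_moment j k 0) = 1"
    by (intro prod.neutral) (force simp: kanter_beta_moment_def)
  thus ?case using j by simp
next
  case (Suc n)
  define m where "m = Suc n"
  define l where "l = j - 1"
  have jl: "j = Suc l" "l \<ge> 1" using j by (auto simp: l_def)
  define P Q where "P = (\<Prod>k\<in>{1..l}. real (m * j + k))" and "Q = (\<Prod>k\<in>{1..l}. real (m * l + k))"
  have prodfact: "fact (q + r) = fact q * (\<Prod>k\<in>{1..r}. real (q + k))" for q r
    by (induction r) (auto simp: prod.nat_ivl_Suc' algebra_simps)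
  have Q0: "Q > 0" unfolding Q_def using jl by (intro prod_pos) (auto intro!: add_nonneg_pos)
  have "(\<Prod>k\<in>{1..l}. (real (m * j + k) / real j) / (real (m * l + k) / real l)) = (P / real j ^ l) / (Q / real l ^ l)"
    unfolding P_def Q_def by (simp only: prod_dividef prod_constant card_atLeastAtMost) simp
  moreover have "(\<Prod>k\<in>{1..j-1}. kanter_beta_moment j k (real (Suc n))) = (\<Prod>k\<in>{1..j-1}. kanter_beta_moment j k (real n))
      * (\<Prod>k\<in>{1..l}. (real (m * j + k) / real j) / (real (m * l + k) / real l))"
    unfolding prod.distrib [symmetric] l_def m_def
    by (intro prod.cong refl kanter_beta_moment_Suc[OF j]) auto
  ultimately have "real j * kanter_const j ^ Suc n * (\<Prod>k\<in>{1..j-1}. kanter_beta_moment j k (real (Suc n)))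
      = (real j * kanter_const j ^ n * (\<Prod>k\<in>{1..j-1}. kanter_beta_moment j k (real n)))
        * (kanter_const j * ((P / real j ^ l) / (Q / real l ^ l)))"
    by (simp only: power_Suc mult_ac)
  \<comment> \<open>Since \<open>kanter_const j = j ^ (l + 1) / l ^ l\<close>, exactly one factor
    \<open>j\<close> survives.\<close>
  also have "kanter_const j * ((P / real j ^ l) / (Q / real l ^ l)) = real j * P / Q"
    using jl Q0 by (simp add: kanter_const_def)
  also have "(real j * kanter_const j ^ n * (\<Prod>k\<in>{1..j-1}. kanter_beta_moment j k (real n))) = real (m * j choose m)"
    using Suc.IH by (simp only: m_def)
  also have "real (m * j choose m) = fact (m * j) / (fact m * fact (m * l))"
    using jl by (subst binomial_fact) auto
  \<comment> \<open>\<open>P\<close> and \<open>Q\<close> stop at \<open>k = l = j - 1\<close>. This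
    completes \<open>fact (m * l + l)\<close> but leaves \<open>fact (m * j + j)\<close> short of
    the factor \<open>m * j + j = (m + 1) * j\<close>, which supplies the extra \<open>j\<close> and
    turns \<open>fact m\<close> into \<open>fact (Suc m)\<close>.\<close>
  also have "fact (m * j) / (fact m * fact (m * l)) * (real j * P / Q) = fact (m * j + j) / (fact (Suc m) * fact (m * l + l))"
  proof -
    have 1: "fact (m * j + l) = fact (m * j) * P" "fact (m * l + l) = fact (m * l) * Q"
      unfolding P_def Q_def by (rule prodfact)+
    have "fact (m * j + j) = real (m * j + j) * fact (m * j + l)"
      using jl by simp
    also have "real (m * j + j) = real (Suc m) * real j" by (simp add: algebra_simps)
    finally have 2: "fact (m * j + j) = real (Suc m) * real j * (fact (m * j) * P)" unfolding 1 .
    define r where "r = real (Suc m)"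
    have "r > 0" by (simp add: r_def)
    thus ?thesis unfolding 1 2 fact_Suc r_def [symmetric] using Q0 by (simp add: divide_simps)
  qed
  also have "\<dots> = real (Suc m * j choose Suc m)"
    using jl by (subst binomial_fact) (auto simp: algebra_simps)
  finally show ?case by (simp add: m_def)
qed

section \<open>Principal powers of positive reals and uniform variables\<close>

lemma of_real_powr_eq_exp:
  assumes "x > 0"
  shows "complex_of_real x powr s = exp (s * of_real (ln x))"
  using assms by (simp add: powr_def Ln_of_real)

text \<open>Principal powers are not multiplicative in general; for nonnegative real bases no
  arguments add up, so the product rule holds.\<close>

lemma of_real_prod_powr:
  assumes "\<And>k. k \<in> A \<Longrightarrow> x k \<ge> (0::real)"
  shows "complex_of_real (\<Prod>k\<in>A. x k) powr s = (\<Prod>k\<in>A. complex_of_real (x k) powr s)"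
proof (cases "finite A")
  case True
  thus ?thesis using assms
  proof induction
    case (insert a A)
    have "complex_of_real (x a * prod x A) powr s = complex_of_real (x a) powr s * complex_of_real (prod x A) powr s"
      using insert.prems by (simp add: powr_times_real prod_nonneg del: of_real_prod)
    thus ?case using insert by (simp del: of_real_prod of_real_mult)
  qed auto
qed auto

lemma AE_distributed_uniform:
  assumes "distributed M lborel X (\<lambda>x. ennreal (uniform_density a b x))"
  shows "AE \<omega> in M. a < X \<omega> \<and> X \<omega> < b"
proof -
  have [measurable]: "X \<in> borel_measurable M"
    using distributed_measurable[OF assms] by simp
  have "uniform_density a b \<in> borel_measurable borel"
    unfolding uniform_density_def[abs_def] by measurable
  hence "AE x in density lborel (\<lambda>x. ennreal (uniform_density a b x)). a < x \<and> x < b"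
    by (subst AE_density) (auto simp: uniform_density_def indicator_def)
  hence "AE x in distr M lborel X. a < x \<and> x < b"
    unfolding distributed_distr_eq_density[OF assms] .
  thus ?thesis by (subst (asm) AE_distr_iff) auto
qed

lemma
  fixes g :: "real \<Rightarrow> 'b :: {banach, second_countable_topology}"
  assumes X: "distributed M lborel X (\<lambda>x. ennreal (uniform_density a b x))" and ab: "a < b"
    and [measurable]: "g \<in> borel_measurable borel"
  shows integrable_distributed_uniform: "integrable M (\<lambda>\<omega>. g (X \<omega>)) \<longleftrightarrow> set_integrable lborel {a<..<b} g"
    and integral_distributed_uniform: "(\<integral>\<omega>. g (X \<omega>) \<partial>M) = (LINT x:{a<..<b}|lborel. g x) /\<^sub>R (b - a)"
proof -
  have [measurable]: "X \<in> borel_measurable M"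
    using distributed_measurable[OF X] by simp
  have [measurable]: "uniform_density a b \<in> borel_measurable borel"
    unfolding uniform_density_def[abs_def] by measurable
  have nn: "uniform_density a b x \<ge> 0" for x using ab by (simp add: uniform_density_def)
  have eq: "uniform_density a b x *\<^sub>R g x = (1 / (b - a)) *\<^sub>R (indicator {a<..<b} x *\<^sub>R g x)" for x
    by (simp add: uniform_density_def)
  have "integrable M (\<lambda>\<omega>. g (X \<omega>)) \<longleftrightarrow> integrable (distr M lborel X) g"
    by (subst integrable_distr_eq) auto
  also have "\<dots> \<longleftrightarrow> integrable lborel (\<lambda>x. uniform_density a b x *\<^sub>R g x)"
    unfolding distributed_distr_eq_density[OF X] using nn by (subst integrable_density) auto
  also have "\<dots> \<longleftrightarrow> set_integrable lborel {a<..<b} g"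
  proof
    assume "integrable lborel (\<lambda>x. uniform_density a b x *\<^sub>R g x)"
    from integrable_scaleR_right[OF this, of "b - a"] ab show "set_integrable lborel {a<..<b} g"
      by (simp add: set_integrable_def uniform_density_def)
  next
    assume "set_integrable lborel {a<..<b} g"
    thus "integrable lborel (\<lambda>x. uniform_density a b x *\<^sub>R g x)"
      unfolding eq set_integrable_def by (intro integrable_scaleR_right)
  qed
  finally show "integrable M (\<lambda>\<omega>. g (X \<omega>)) \<longleftrightarrow> set_integrable lborel {a<..<b} g" .
  have "(\<integral>\<omega>. g (X \<omega>) \<partial>M) = integral\<^sup>L (distr M lborel X) g"
    by (subst integral_distr) auto
  also have "\<dots> = (\<integral>x. uniform_density a b x *\<^sub>R g x \<partial>lborel)"
    unfolding distributed_distr_eq_density[OF X] using nn by (subst integral_density) auto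
  also have "\<dots> = (LINT x:{a<..<b}|lborel. g x) /\<^sub>R (b - a)"
    unfolding eq set_lebesgue_integral_def integral_scaleR_right by (simp add: inverse_eq_divide)
  finally show "(\<integral>\<omega>. g (X \<omega>) \<partial>M) = (LINT x:{a<..<b}|lborel. g x) /\<^sub>R (b - a)" .
qed

section \<open>From moments to laws and complex moments\<close>

context prob_space
begin

lemma
  assumes j: "j \<ge> 2" and U: "distributed M lborel U (\<lambda>x. ennreal (uniform_density 0 pi x))"
  shows AE_kanter_recip: "AE \<omega> in M. 0 < kanter_recip j (U \<omega>) \<and> kanter_recip j (U \<omega>) \<le> kanter_const j"
    and AE_kanter_a: "AE \<omega> in M. kanter_a (1 - 1 / real j) (U \<omega>) = 1 / kanter_recip j (U \<omega>)"
    and integrable_kanter_recip_power: "integrable M (\<lambda>\<omega>. kanter_recip j (U \<omega>) ^ n)"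
    and integral_kanter_recip_power: "expectation (\<lambda>\<omega>. kanter_recip j (U \<omega>) ^ n) = real (n * j choose n)"
proof -
  note AE = AE_distributed_uniform[OF U]
  show "AE \<omega> in M. 0 < kanter_recip j (U \<omega>) \<and> kanter_recip j (U \<omega>) \<le> kanter_const j"
    using AE by eventually_elim (auto intro: kanter_recip_pos kanter_recip_le_const j)
  show "AE \<omega> in M. kanter_a (1 - 1 / real j) (U \<omega>) = 1 / kanter_recip j (U \<omega>)"
    using AE by eventually_elim (auto intro: kanter_a_eq j)
  show "integrable M (\<lambda>\<omega>. kanter_recip j (U \<omega>) ^ n)"
    using integrable_distributed_uniform[OF U, of "\<lambda>x. kanter_recip j x ^ n"] kanter_recip_moment(1)[OF j]
    by simp
  show "expectation (\<lambda>\<omega>. kanter_recip j (U \<omega>) ^ n) = real (n * j choose n)"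
    using integral_distributed_uniform[OF U, of "\<lambda>x. kanter_recip j x ^ n"] kanter_recip_moment(2)[OF j]
    by simp
qed

lemma
  assumes j: "j \<ge> 2"
    and \<beta>: "\<And>k. k \<in> {1..j-1} \<Longrightarrow> distributed M lborel (\<beta> k) (\<lambda>t. ennreal (kanter_beta_density j k t))"
    and ind: "indep_vars (\<lambda>_. borel) \<beta> {1..j-1}"
  shows AE_prod_kanter_beta: "AE \<omega> in M. (\<forall>k\<in>{1..j-1}. 0 < \<beta> k \<omega>) \<and> 0 < (\<Prod>k\<in>{1..j-1}. \<beta> k \<omega>) \<and> (\<Prod>k\<in>{1..j-1}. \<beta> k \<omega>) < 1"
    and integrable_prod_kanter_beta_powr: 
      "p > - 1 - 1 / real j \<Longrightarrow> integrable M (\<lambda>\<omega>. (\<Prod>k\<in>{1..j-1}. \<beta> k \<omega>) powr p)"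
    and integral_prod_kanter_beta_powr: 
      "p > - 1 - 1 / real j \<Longrightarrow> expectation (\<lambda>\<omega>. (\<Prod>k\<in>{1..j-1}. \<beta> k \<omega>) powr p) = (\<Prod>k\<in>{1..j-1}. kanter_beta_moment j k p)"
proof -
  have [measurable]: "\<beta> k \<in> borel_measurable M" if "k \<in> {1..j-1}" for k
    using distributed_measurable[OF \<beta>[OF that]] by simp
  have "AE \<omega> in M. \<forall>k\<in>{1..j-1}. 0 < \<beta> k \<omega> \<and> \<beta> k \<omega> < 1"
    using AE_kanter_beta[OF j _ \<beta>] by (intro AE_finite_allI) auto
  thus AE: "AE \<omega> in M. (\<forall>k\<in>{1..j-1}. 0 < \<beta> k \<omega>) \<and> 0 < (\<Prod>k\<in>{1..j-1}. \<beta> k \<omega>) \<and> (\<Prod>k\<in>{1..j-1}. \<beta> k \<omega>) < 1"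
  proof eventually_elim
    case (elim \<omega>)
    have "(\<Prod>k\<in>{1..j-1}. \<beta> k \<omega>) < (\<Prod>k\<in>{1..j-1}. 1)"
      using elim j by (intro prod_mono_strict[of 1]) (auto intro: less_imp_le)
    with elim show ?case by (auto intro!: prod_pos)
  qed
  assume p: "p > - 1 - 1 / real j"
  \<comment> \<open>The first Beta variable, \<open>k = 1\<close>, imposes the strictest bound on
    negative exponents.\<close>
  have p': "p > - 1 - real k / real j" if "k \<in> {1..j-1}" for k
  proof -
    have "1 / real j \<le> real k / real j" using that j by (intro divide_right_mono) auto
    thus ?thesis using p by linarith
  qed
  have eq: "AE \<omega> in M. (\<Prod>k\<in>{1..j-1}. \<beta> k \<omega>) powr p = (\<Prod>k\<in>{1..j-1}. \<beta> k \<omega> powr p)"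
    using AE by eventually_elim (auto intro!: prod_powr_distrib less_imp_le)
  have ind': "indep_vars (\<lambda>_. borel) (\<lambda>k \<omega>. \<beta> k \<omega> powr p) {1..j-1}"
    using indep_vars_compose2[OF ind, of "\<lambda>_ x. x powr p" "\<lambda>_. borel"] by simp
  have int: "integrable M (\<lambda>\<omega>. \<beta> k \<omega> powr p)" if "k \<in> {1..j-1}" for k
    using that by (intro integrable_kanter_beta_powr[OF j _ \<beta>] p') auto
  have "integrable M (\<lambda>\<omega>. \<Prod>k\<in>{1..j-1}. \<beta> k \<omega> powr p)"
    by (intro indep_vars_integrable ind' int) auto
  thus "integrable M (\<lambda>\<omega>. (\<Prod>k\<in>{1..j-1}. \<beta> k \<omega>) powr p)"
    using eq by (subst integrable_cong_AE) auto
  have "expectation (\<lambda>\<omega>. (\<Prod>k\<in>{1..j-1}. \<beta> k \<omega>) powr p) = expectation (\<lambda>\<omega>. \<Prod>k\<in>{1..j-1}. \<beta> k \<omega> powr p)"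
    using eq by (intro integral_cong_AE) auto
  also have "\<dots> = (\<Prod>k\<in>{1..j-1}. expectation (\<lambda>\<omega>. \<beta> k \<omega> powr p))"
    by (intro indep_vars_lebesgue_integral ind' int) auto
  also have "\<dots> = (\<Prod>k\<in>{1..j-1}. kanter_beta_moment j k p)"
    by (intro prod.cong refl integral_kanter_beta_powr[OF j _ \<beta>] p') auto
  finally show "expectation (\<lambda>\<omega>. (\<Prod>k\<in>{1..j-1}. \<beta> k \<omega>) powr p) = (\<Prod>k\<in>{1..j-1}. kanter_beta_moment j k p)" .
qed

text \<open>The weight contributes one power of \<open>kanter_recip\<close>, so the
  \<open>n\<close>-th moment on the left comes from the integer moment of order
  \<open>n + 1\<close>, which matches \<open>prod_kanter_beta_moment\<close>. The case
  \<open>n = 0\<close> says that the weighted measure has total mass 1.\<close>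

lemma density_kanter_recip_eq_distr_prod_beta:
  assumes j: "j \<ge> 2" and U: "distributed M lborel U (\<lambda>x. ennreal (uniform_density 0 pi x))"
    and \<beta>: "\<And>k. k \<in> {1..j-1} \<Longrightarrow> distributed M lborel (\<beta> k) (\<lambda>t. ennreal (kanter_beta_density j k t))"
    and ind: "indep_vars (\<lambda>_. borel) \<beta> {1..j-1}"
  shows "density (distr M borel (\<lambda>\<omega>. kanter_recip j (U \<omega>) / kanter_const j)) (\<lambda>y. ennreal (kanter_const j / real j * y))
       = distr M borel (\<lambda>\<omega>. \<Prod>k\<in>{1..j-1}. \<beta> k \<omega>)" (is "?\<mu> = ?\<nu>")
proof -
  let ?W = "\<lambda>\<omega>. \<Prod>k\<in>{1..j-1}. \<beta> k \<omega>"
  define C where "C = kanter_const j"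
  define Y where "Y \<omega> = kanter_recip j (U \<omega>) / C" for \<omega>
  have C: "C > 0" using j by (simp add: C_def kanter_const_def)
  have [measurable]: "U \<in> borel_measurable M" using distributed_measurable[OF U] by simp
  have [measurable]: "\<beta> k \<in> borel_measurable M" if "k \<in> {1..j-1}" for k
    using distributed_measurable[OF \<beta>[OF that]] by simp
  have [measurable]: "Y \<in> borel_measurable M" unfolding Y_def by measurable
  have Y: "AE \<omega> in M. 0 < Y \<omega> \<and> Y \<omega> \<le> 1"
    using AE_kanter_recip[OF j U] C by (auto simp: Y_def C_def)
  hence Yd: "AE y in distr M borel Y. 0 < y \<and> y \<le> 1"
    by (subst AE_distr_iff) auto
  hence nn: "AE y in distr M borel Y. 0 \<le> C / real j * y"
  proof eventually_elim
    case (elim y)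
    thus ?case using C by simp
  qed
  have \<mu>: "?\<mu> = density (distr M borel Y) (\<lambda>y. ennreal (C / real j * y))"
    by (simp add: Y_def[abs_def] C_def)
  have mom: "(\<integral>y. y ^ n \<partial>?\<mu>) = (\<Prod>k\<in>{1..j-1}. kanter_beta_moment j k (real n))" for n
  proof -
    have "(\<integral>y. y ^ n \<partial>?\<mu>) = (\<integral>\<omega>. C / real j * Y \<omega> * Y \<omega> ^ n \<partial>M)"
      unfolding \<mu> using nn by (subst integral_real_density) (auto simp: integral_distr)
    also have "\<dots> = (\<integral>\<omega>. kanter_recip j (U \<omega>) ^ Suc n / (C ^ n * real j) \<partial>M)"
      using C by (intro Bochner_Integration.integral_cong) (auto simp: Y_def power_divide field_simps)
    also have "\<dots> = real (Suc n * j choose Suc n) / (C ^ n * real j)"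
      by (simp only: integral_divide_zero integral_kanter_recip_power[OF j U])
    also have "\<dots> = (\<Prod>k\<in>{1..j-1}. kanter_beta_moment j k (real n))"
      unfolding prod_kanter_beta_moment[OF j, symmetric] using C j by (simp add: C_def)
    finally show ?thesis .
  qed
  have int1: "integrable (distr M borel Y) (\<lambda>y. C / real j * y)"
    using integrable_kanter_recip_power[OF j U, of 1] C
    by (subst integrable_distr_eq) (auto simp: Y_def[abs_def])
  have "emeasure ?\<mu> (space ?\<mu>) = (\<integral>\<^sup>+y. ennreal (C / real j * y) \<partial>distr M borel Y)"
    unfolding \<mu> by (subst emeasure_density) (auto intro!: nn_integral_cong)
  also have "\<dots> = ennreal (\<integral>y. C / real j * y \<partial>distr M borel Y)"
    by (rule nn_integral_eq_integral[OF int1 nn])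
  also have "(\<integral>y. C / real j * y \<partial>distr M borel Y) = (\<integral>y. y ^ 0 \<partial>?\<mu>)"
    unfolding \<mu> using nn by (subst integral_real_density) auto
  also have "\<dots> = 1"
  proof -
    have "real j * (\<Prod>k\<in>{1..j-1}. kanter_beta_moment j k (real 0)) = real j"
      using prod_kanter_beta_moment[OF j, of 0] by simp
    thus ?thesis unfolding mom using j by simp
  qed
  finally have "prob_space ?\<mu>" by (intro prob_spaceI) simp
  hence 1: "real_distribution ?\<mu>"
    by (simp add: real_distribution_def real_distribution_axioms_def)
  have 2: "real_distribution ?\<nu>" by (intro real_distribution_distr) measurable
  have W: "AE \<omega> in M. (\<forall>k\<in>{1..j-1}. 0 < \<beta> k \<omega>) \<and> 0 < ?W \<omega> \<and> ?W \<omega> < 1"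
    by (rule AE_prod_kanter_beta[OF j \<beta> ind])
  show ?thesis
  proof (rule real_distribution_eqI_moments[OF 1 2])
    show "AE x in ?\<mu>. \<bar>x\<bar> \<le> 1"
      unfolding \<mu> using Yd by (subst AE_density) auto
    show "AE x in ?\<nu>. \<bar>x\<bar> \<le> 1"
      using W by (subst AE_distr_iff) auto
    fix n
    have "1 / real j \<ge> 0" by simp
    hence "- 1 - 1 / real j < real n" by linarith
    hence "expectation (\<lambda>\<omega>. ?W \<omega> powr real n) = (\<integral>y. y ^ n \<partial>?\<mu>)"
      unfolding mom using integral_prod_kanter_beta_powr[OF j \<beta> ind] by simp
    moreover have "expectation (\<lambda>\<omega>. ?W \<omega> powr real n) = expectation (\<lambda>\<omega>. ?W \<omega> ^ n)"
    proof (rule integral_cong_AE)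
      show "AE \<omega> in M. ?W \<omega> powr real n = ?W \<omega> ^ n"
        using W by eventually_elim (auto simp: powr_realpow)
    qed measurable
    moreover have "(\<integral>y. y ^ n \<partial>?\<nu>) = expectation (\<lambda>\<omega>. ?W \<omega> ^ n)"
      by (subst integral_distr) auto
    ultimately show "(\<integral>y. y ^ n \<partial>?\<mu>) = (\<integral>y. y ^ n \<partial>?\<nu>)" by simp
  qed
qed

text \<open>Integrate \<open>y powr (s - 1)\<close> against the two equal laws. Integrability is
  established on the Beta side, where the condition on \<open>Re s\<close> is
  \<open>Re s - 1 > - 1 - 1/j\<close>, and then transported to the Kanter side.\<close>

lemma
  assumes j: "j \<ge> 2" and U: "distributed M lborel U (\<lambda>x. ennreal (uniform_density 0 pi x))"
    and \<beta>: "\<And>k. k \<in> {1..j-1} \<Longrightarrow> distributed M lborel (\<beta> k) (\<lambda>t. ennreal (kanter_beta_density j k t))"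
    and ind: "indep_vars (\<lambda>_. borel) \<beta> {1..j-1}"
    and s: "Re s > - 1 / real j"
  shows integrable_kanter_recip_powr: "integrable M (\<lambda>\<omega>. complex_of_real (kanter_recip j (U \<omega>)) powr s)"
    and integrable_prod_beta_powr: "integrable M (\<lambda>\<omega>. complex_of_real (\<Prod>k\<in>{1..j-1}. \<beta> k \<omega>) powr (s - 1))"
    and integral_kanter_recip_powr: "(\<integral>\<omega>. complex_of_real (kanter_recip j (U \<omega>)) powr s \<partial>M)
          = of_nat j * complex_of_real (kanter_const j) powr (s - 1)
            * (\<integral>\<omega>. complex_of_real (\<Prod>k\<in>{1..j-1}. \<beta> k \<omega>) powr (s - 1) \<partial>M)"
proof -
  let ?W = "\<lambda>\<omega>. \<Prod>k\<in>{1..j-1}. \<beta> k \<omega>"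
  let ?X = "\<lambda>\<omega>. kanter_recip j (U \<omega>)"
  define C where "C = kanter_const j"
  define Y where "Y \<omega> = ?X \<omega> / C" for \<omega>
  define g where "g y = complex_of_real y powr (s - 1)" for y :: real
  have C: "C > 0" using j by (simp add: C_def kanter_const_def)
  have [measurable]: "U \<in> borel_measurable M" using distributed_measurable[OF U] by simp
  have [measurable]: "\<beta> k \<in> borel_measurable M" if "k \<in> {1..j-1}" for k
    using distributed_measurable[OF \<beta>[OF that]] by simp
  have [measurable]: "Y \<in> borel_measurable M" unfolding Y_def by measurable
  have [measurable]: "g \<in> borel_measurable borel" unfolding g_def by measurable
  have Y: "AE \<omega> in M. 0 < Y \<omega>"
    using AE_kanter_recip[OF j U] C by (auto simp: Y_def)
  hence nn: "AE y in distr M borel Y. 0 \<le> C / real j * y"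
    using C by (subst AE_distr_iff) auto
  have law: "density (distr M borel Y) (\<lambda>y. ennreal (C / real j * y)) = distr M borel ?W"
    using density_kanter_recip_eq_distr_prod_beta[OF j U \<beta> ind] by (simp add: Y_def[abs_def] C_def)
  have W01: "AE \<omega> in M. (\<forall>k\<in>{1..j-1}. 0 < \<beta> k \<omega>) \<and> 0 < ?W \<omega> \<and> ?W \<omega> < 1"
    by (rule AE_prod_kanter_beta[OF j \<beta> ind])
  have intW: "integrable M (\<lambda>\<omega>. g (?W \<omega>))"
  proof (rule Bochner_Integration.integrable_bound)
    show "integrable M (\<lambda>\<omega>. ?W \<omega> powr (Re s - 1))"
      using s by (intro integrable_prod_kanter_beta_powr[OF j \<beta> ind]) auto
    show "AE \<omega> in M. norm (g (?W \<omega>)) \<le> norm (?W \<omega> powr (Re s - 1))"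
      using W01 by eventually_elim (simp add: g_def norm_powr_real_powr del: of_real_prod)
  qed measurable
  thus "integrable M (\<lambda>\<omega>. complex_of_real (?W \<omega>) powr (s - 1))" unfolding g_def .
  define c where "c = of_nat j * complex_of_real C powr (s - 1)"
  \<comment> \<open>With \<open>X = C * Y\<close>, the size-bias weight \<open>C / j * Y\<close>
    supplies the missing power of \<open>Y\<close>, and \<open>c\<close> restores \<open>j\<close>
    and the powers of \<open>C\<close>.\<close>
  have eq: "AE \<omega> in M. c * ((C / real j * Y \<omega>) *\<^sub>R g (Y \<omega>)) = complex_of_real (?X \<omega>) powr s"
    using Y
  proof eventually_elim
    case (elim \<omega>)
    have p: "complex_of_real x * complex_of_real x powr (s - 1) = complex_of_real x powr s" if "x > 0" for x
      using that by (simp add: powr_diff)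
    have "c * ((C / real j * Y \<omega>) *\<^sub>R g (Y \<omega>)) =
        (complex_of_real C * complex_of_real C powr (s - 1)) * (complex_of_real (Y \<omega>) * complex_of_real (Y \<omega>) powr (s - 1))"
      using j by (simp add: c_def g_def scaleR_conv_of_real)
    also have "\<dots> = complex_of_real C powr s * complex_of_real (Y \<omega>) powr s"
      using elim C by (simp only: p)
    also have "\<dots> = complex_of_real (C * Y \<omega>) powr s"
      using elim C by (simp add: powr_times_real)
    finally show ?case using C by (simp add: Y_def)
  qed
  have "integrable (density (distr M borel Y) (\<lambda>y. ennreal (C / real j * y))) g"
    unfolding law using intW by (subst integrable_distr_eq) auto
  hence intY: "integrable M (\<lambda>\<omega>. (C / real j * Y \<omega>) *\<^sub>R g (Y \<omega>))"
    using nn by (subst (asm) integrable_density) (auto simp: integrable_distr_eq)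
  hence "integrable M (\<lambda>\<omega>. c * ((C / real j * Y \<omega>) *\<^sub>R g (Y \<omega>)))"
    by (rule integrable_mult_right)
  thus "integrable M (\<lambda>\<omega>. complex_of_real (?X \<omega>) powr s)"
    using eq by (subst (asm) integrable_cong_AE) auto
  have "(\<integral>\<omega>. complex_of_real (?X \<omega>) powr s \<partial>M) = (\<integral>\<omega>. c * ((C / real j * Y \<omega>) *\<^sub>R g (Y \<omega>)) \<partial>M)"
    using eq by (intro integral_cong_AE) auto
  also have "\<dots> = c * (\<integral>\<omega>. (C / real j * Y \<omega>) *\<^sub>R g (Y \<omega>) \<partial>M)"
    by (rule integral_mult_right_zero)
  also have "(\<integral>\<omega>. (C / real j * Y \<omega>) *\<^sub>R g (Y \<omega>) \<partial>M) = (\<integral>y. g y \<partial>density (distr M borel Y) (\<lambda>y. ennreal (C / real j * y)))"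
    using nn by (subst integral_density) (auto simp: integral_distr)
  also have "\<dots> = (\<integral>\<omega>. g (?W \<omega>) \<partial>M)"
    unfolding law by (subst integral_distr) auto
  finally show "(\<integral>\<omega>. complex_of_real (?X \<omega>) powr s \<partial>M)
          = of_nat j * complex_of_real (kanter_const j) powr (s - 1) * (\<integral>\<omega>. complex_of_real (?W \<omega>) powr (s - 1) \<partial>M)"
    unfolding c_def g_def C_def .
qed

text \<open>Index 0 encodes \<open>V\<close>, so \<open>ind\<close> is joint independence of
  \<open>V\<close> and the Beta variables. For \<open>Re s > 0\<close> the mean factors and
  \<open>V\<close> contributes \<open>1 / s\<close>. For \<open>Re s \<le> 0\<close> the power of
  \<open>V\<close> alone already obstructs integrability.\<close>

lemma
  assumes j: "j \<ge> 2"
    and \<beta>: "\<And>k. k \<in> {1..j-1} \<Longrightarrow> distributed M lborel (\<beta> k) (\<lambda>t. ennreal (kanter_beta_density j k t))"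
    and V: "distributed M lborel V (\<lambda>x. ennreal (uniform_density 0 1 x))"
    and ind: "indep_vars (\<lambda>_. borel) (\<lambda>k. if k = 0 then V else \<beta> k) {0..j-1}"
    and C: "C > 0"
  shows integrable_uniform_prod_beta_powr: "Re s > 0 \<Longrightarrow>
      integrable M (\<lambda>\<omega>. complex_of_real (C * V \<omega> * (\<Prod>k\<in>{1..j-1}. \<beta> k \<omega>)) powr (s - 1))"
    and integral_uniform_prod_beta_powr: "Re s > 0 \<Longrightarrow>
      (\<integral>\<omega>. complex_of_real (C * V \<omega> * (\<Prod>k\<in>{1..j-1}. \<beta> k \<omega>)) powr (s - 1) \<partial>M)
         = complex_of_real C powr (s - 1) * (\<integral>\<omega>. complex_of_real (\<Prod>k\<in>{1..j-1}. \<beta> k \<omega>) powr (s - 1) \<partial>M) / s"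
    and not_integrable_uniform_prod_beta_powr: "Re s \<le> 0 \<Longrightarrow>
      \<not> integrable M (\<lambda>\<omega>. complex_of_real (C * V \<omega> * (\<Prod>k\<in>{1..j-1}. \<beta> k \<omega>)) powr (s - 1))"
proof -
  let ?W = "\<lambda>\<omega>. \<Prod>k\<in>{1..j-1}. \<beta> k \<omega>"
  define g where "g y = complex_of_real y powr (s - 1)" for y :: real
  have [measurable]: "g \<in> borel_measurable borel" unfolding g_def by measurable
  have [measurable]: "V \<in> borel_measurable M" using distributed_measurable[OF V] by simp
  have [measurable]: "\<beta> k \<in> borel_measurable M" if "k \<in> {1..j-1}" for k
    using distributed_measurable[OF \<beta>[OF that]] by simp
  have ind_beta: "indep_vars (\<lambda>_. borel) \<beta> {1..j-1}"
  proof -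
    have "indep_vars (\<lambda>_. borel) (\<lambda>k. if k = 0 then V else \<beta> k) {1..j-1}"
      by (rule indep_vars_subset[OF ind]) auto
    thus ?thesis by (subst (asm) indep_vars_cong[of _ "{1..j-1}" _ \<beta>]) auto
  qed
  note V01 = AE_distributed_uniform[OF V]
  have W01: "AE \<omega> in M. (\<forall>k\<in>{1..j-1}. 0 < \<beta> k \<omega>) \<and> 0 < ?W \<omega> \<and> ?W \<omega> < 1"
    by (rule AE_prod_kanter_beta[OF j \<beta> ind_beta])
  have split: "AE \<omega> in M. complex_of_real (C * V \<omega> * ?W \<omega>) powr (s - 1) =
      complex_of_real C powr (s - 1) * (\<Prod>k\<in>{0..j-1}. g ((if k = 0 then V else \<beta> k) \<omega>))"
    using V01 W01
  proof eventually_elim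
    case (elim \<omega>)
    have "complex_of_real (C * V \<omega> * ?W \<omega>) powr (s - 1)
        = complex_of_real C powr (s - 1) * (g (V \<omega>) * complex_of_real (?W \<omega>) powr (s - 1))"
      using elim C by (simp add: g_def powr_times_real prod_nonneg less_imp_le del: of_real_prod)
    also have "complex_of_real (?W \<omega>) powr (s - 1) = (\<Prod>k\<in>{1..j-1}. g (\<beta> k \<omega>))"
      unfolding g_def using elim by (intro of_real_prod_powr) (auto intro: less_imp_le)
    also have "g (V \<omega>) * (\<Prod>k\<in>{1..j-1}. g (\<beta> k \<omega>)) = (\<Prod>k\<in>{0..j-1}. g ((if k = 0 then V else \<beta> k) \<omega>))"
      by (subst prod.atLeast_Suc_atMost) (auto intro!: arg_cong2[where f = "(*)"] prod.cong)
    finally show ?case .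
  qed
  have splitW: "AE \<omega> in M. complex_of_real (?W \<omega>) powr (s - 1) = (\<Prod>k\<in>{1..j-1}. g (\<beta> k \<omega>))"
    using W01 unfolding g_def by eventually_elim (intro of_real_prod_powr, auto intro: less_imp_le)
  {
    assume s: "Re s > 0"
    have VI: "integrable M (\<lambda>\<omega>. g (V \<omega>))" "(\<integral>\<omega>. g (V \<omega>) \<partial>M) = 1 / s"
      using integrable_distributed_uniform[OF V, of g] integral_distributed_uniform[OF V, of g]
        set_integrable_powr_from_0[OF s, of 1] LINT_powr_from_0[OF s, of 1]
      by (auto simp: g_def[abs_def])
    have \<beta>I: "integrable M (\<lambda>\<omega>. g (\<beta> k \<omega>))" if k: "k \<in> {1..j-1}" for k
    proof (rule Bochner_Integration.integrable_bound)
      have "- real k / real j \<le> 0" by simp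
      hence "Re s - 1 > - 1 - real k / real j" using s by linarith
      thus "integrable M (\<lambda>\<omega>. \<beta> k \<omega> powr (Re s - 1))"
        using k by (intro integrable_kanter_beta_powr[OF j _ \<beta>[OF k]]) auto
      show "AE \<omega> in M. norm (g (\<beta> k \<omega>)) \<le> norm (\<beta> k \<omega> powr (Re s - 1))"
        using W01
      proof eventually_elim
        case (elim \<omega>)
        hence "0 < \<beta> k \<omega>" using k by blast
        thus ?case by (simp add: g_def norm_powr_real_powr)
      qed
    qed (use k in measurable)
    have int: "integrable M (\<lambda>\<omega>. g ((if k = 0 then V else \<beta> k) \<omega>))" if "k \<in> {0..j-1}" for k
      using that VI(1) \<beta>I[of k] by (cases "k = 0") auto
    have ind1: "indep_vars (\<lambda>_. borel) (\<lambda>k \<omega>. g ((if k = 0 then V else \<beta> k) \<omega>)) {0..j-1}"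
      using indep_vars_compose2[OF ind, of "\<lambda>_. g" "\<lambda>_. borel"] by simp
    have ind2: "indep_vars (\<lambda>_. borel) (\<lambda>k \<omega>. g (\<beta> k \<omega>)) {1..j-1}"
      using indep_vars_compose2[OF ind_beta, of "\<lambda>_. g" "\<lambda>_. borel"] by simp
    have meas: "(\<lambda>\<omega>. \<Prod>k\<in>{0..j-1}. g ((if k = 0 then V else \<beta> k) \<omega>)) \<in> borel_measurable M"
      using int by (intro borel_measurable_prod) auto
    have "integrable M (\<lambda>\<omega>. complex_of_real C powr (s - 1) * (\<Prod>k\<in>{0..j-1}. g ((if k = 0 then V else \<beta> k) \<omega>)))"
      by (intro integrable_mult_right indep_vars_integrable ind1 int) auto
    thus "integrable M (\<lambda>\<omega>. complex_of_real (C * V \<omega> * ?W \<omega>) powr (s - 1))"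
      by (rule Bochner_Integration.integrable_cong_AE_imp) (use split in auto)
    have "(\<integral>\<omega>. complex_of_real (C * V \<omega> * ?W \<omega>) powr (s - 1) \<partial>M)
        = (\<integral>\<omega>. complex_of_real C powr (s - 1) * (\<Prod>k\<in>{0..j-1}. g ((if k = 0 then V else \<beta> k) \<omega>)) \<partial>M)"
      using split meas by (intro integral_cong_AE) auto
    also have "\<dots> = complex_of_real C powr (s - 1) * (\<Prod>k\<in>{0..j-1}. \<integral>\<omega>. g ((if k = 0 then V else \<beta> k) \<omega>) \<partial>M)"
      by (subst integral_mult_right_zero, subst indep_vars_lebesgue_integral[OF _ ind1 int]) auto
    also have "(\<Prod>k\<in>{0..j-1}. \<integral>\<omega>. g ((if k = 0 then V else \<beta> k) \<omega>) \<partial>M)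
        = (\<integral>\<omega>. g (V \<omega>) \<partial>M) * (\<Prod>k\<in>{1..j-1}. \<integral>\<omega>. g (\<beta> k \<omega>) \<partial>M)"
      by (subst prod.atLeast_Suc_atMost) (auto intro!: arg_cong2[where f = "(*)"] prod.cong)
    also have "(\<Prod>k\<in>{1..j-1}. \<integral>\<omega>. g (\<beta> k \<omega>) \<partial>M) = (\<integral>\<omega>. (\<Prod>k\<in>{1..j-1}. g (\<beta> k \<omega>)) \<partial>M)"
      by (rule indep_vars_lebesgue_integral[symmetric, OF _ ind2 \<beta>I]) auto
    also have "\<dots> = (\<integral>\<omega>. complex_of_real (?W \<omega>) powr (s - 1) \<partial>M)"
      using splitW by (intro integral_cong_AE) auto
    finally show "(\<integral>\<omega>. complex_of_real (C * V \<omega> * ?W \<omega>) powr (s - 1) \<partial>M)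
         = complex_of_real C powr (s - 1) * (\<integral>\<omega>. complex_of_real (?W \<omega>) powr (s - 1) \<partial>M) / s"
      unfolding VI(2) by simp
  }
  assume s: "Re s \<le> 0"
  show "\<not> integrable M (\<lambda>\<omega>. complex_of_real (C * V \<omega> * ?W \<omega>) powr (s - 1))"
  proof
    assume "integrable M (\<lambda>\<omega>. complex_of_real (C * V \<omega> * ?W \<omega>) powr (s - 1))"
    \<comment> \<open>The prefactor cancels the power of \<open>C\<close>, leaving the powers of
      \<open>V\<close> and of the product.\<close>
    hence "integrable M (\<lambda>\<omega>. C powr (1 - Re s) * norm (complex_of_real (C * V \<omega> * ?W \<omega>) powr (s - 1)))"
      by (intro integrable_mult_right integrable_norm)
    hence "integrable M (\<lambda>\<omega>. V \<omega> powr (Re s - 1))"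
    proof (rule Bochner_Integration.integrable_bound)
      show "AE \<omega> in M. norm (V \<omega> powr (Re s - 1)) \<le>
          norm (C powr (1 - Re s) * norm (complex_of_real (C * V \<omega> * ?W \<omega>) powr (s - 1)))"
        using V01 W01
      proof eventually_elim
        case (elim \<omega>)
        define w where "w = ?W \<omega>"
        have w: "0 < w" "w < 1" using elim by (auto simp: w_def)
        have "norm (complex_of_real (C * V \<omega> * w) powr (s - 1)) = (C * V \<omega> * w) powr (Re s - 1)"
          using elim C w by (subst norm_powr_real_powr) (auto intro!: mult_nonneg_nonneg simp: less_imp_le)
        also have "\<dots> = C powr (Re s - 1) * V \<omega> powr (Re s - 1) * w powr (Re s - 1)"
          using elim C w by (simp add: powr_mult)
        finally have eq: "C powr (1 - Re s) * norm (complex_of_real (C * V \<omega> * w) powr (s - 1))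
            = (C powr (1 - Re s) * C powr (Re s - 1)) * V \<omega> powr (Re s - 1) * w powr (Re s - 1)"
          by simp
        have C1: "C powr (1 - Re s) * C powr (Re s - 1) = 1"
          using C by (simp add: powr_add [symmetric])
        have "1 = 1 powr (Re s - 1)" by simp
        \<comment> \<open>Since \<open>0 < w < 1\<close> and the exponent is negative, the product
          only enlarges the integrand, so the power of \<open>V\<close> is a lower bound.\<close>
        also have "\<dots> \<le> w powr (Re s - 1)" using w s by (intro powr_mono2') auto
        finally have "V \<omega> powr (Re s - 1) * 1 \<le> V \<omega> powr (Re s - 1) * w powr (Re s - 1)"
          by (intro mult_left_mono) auto
        thus ?case unfolding w_def [symmetric] eq C1 by simp
      qed
    qed measurable
    hence "set_integrable lborel {0<..<1} (\<lambda>v. v powr (Re s - 1))"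
      using integrable_distributed_uniform[OF V, of "\<lambda>v. v powr (Re s - 1)"] by simp
    with not_set_integrable_powr_from_0[of "Re s - 1" 1] s show False by simp
  qed
qed

end

section \<open>Both identities and the holomorphic continuation\<close>

theorem mainTheorem2:
  fixes M :: "'a measure" and U :: "'a \<Rightarrow> real" and \<beta> :: "nat \<Rightarrow> 'a \<Rightarrow> real" and j :: nat
  assumes "prob_space M"
    and "j \<ge> 2"
    and "distributed M lborel U (\<lambda>x. ennreal (uniform_density 0 pi x))"
    and "\<And>k. k \<in> {1..j-1} \<Longrightarrow>
           distributed M lborel (\<beta> k) (\<lambda>t. ennreal (kanter_beta_density j k t))"
    and "prob_space.indep_vars M (\<lambda>_. borel) \<beta> {1..j-1}"
  shows
    "(\<forall>s. Re s > - 1 / real j \<longrightarrow>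
        integrable M (\<lambda>\<omega>. 1 / complex_of_real (kanter_a (1 - 1 / real j) (U \<omega>)) powr s) \<and>
        integrable M (\<lambda>\<omega>. complex_of_real (\<Prod>k\<in>{1..j-1}. \<beta> k \<omega>) powr (s - 1)) \<and>
        (\<integral>\<omega>. 1 / complex_of_real (kanter_a (1 - 1 / real j) (U \<omega>)) powr s \<partial>M)
          = of_nat j * complex_of_real (kanter_const j) powr (s - 1)
            * (\<integral>\<omega>. complex_of_real (\<Prod>k\<in>{1..j-1}. \<beta> k \<omega>) powr (s - 1) \<partial>M))
   \<and> (\<forall>V. distributed M lborel V (\<lambda>x. ennreal (uniform_density 0 1 x)) \<longrightarrow>
          prob_space.indep_vars M (\<lambda>_. borel) (\<lambda>k. if k = 0 then V else \<beta> k) {0..j-1} \<longrightarrow>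
        (\<forall>s. Re s > 0 \<longrightarrow>
           set_integrable lborel {0<..}
             (tail_integrand M (\<lambda>\<omega>. kanter_a (1 - 1 / real j) (U \<omega>)) s) \<and>
           integrable M (\<lambda>\<omega>. complex_of_real
             (kanter_const j * V \<omega> * (\<Prod>k\<in>{1..j-1}. \<beta> k \<omega>)) powr (s - 1)))
      \<and> (\<forall>s. Re s > - 1 / real j \<and> s \<noteq> 0 \<longrightarrow>
           (LINT u:{0<..}|lborel.
              tail_integrand M (\<lambda>\<omega>. kanter_a (1 - 1 / real j) (U \<omega>)) s u)
           = of_nat j * (\<integral>\<omega>. complex_of_real
               (kanter_const j * V \<omega> * (\<Prod>k\<in>{1..j-1}. \<beta> k \<omega>)) powr (s - 1) \<partial>M))
      \<and> (\<exists>L R.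
           holomorphic_continuation L
             (\<lambda>s. LINT u:{0<..}|lborel.
                tail_integrand M (\<lambda>\<omega>. kanter_a (1 - 1 / real j) (U \<omega>)) s u)
             {s. Re s > 0} {s. Re s > - 1 / real j \<and> s \<noteq> 0} \<and>
           holomorphic_continuation R
             (\<lambda>s. of_nat j * (\<integral>\<omega>. complex_of_real
                (kanter_const j * V \<omega> * (\<Prod>k\<in>{1..j-1}. \<beta> k \<omega>)) powr (s - 1) \<partial>M))
             {s. Re s > 0} {s. Re s > - 1 / real j \<and> s \<noteq> 0} \<and>
           (\<forall>s. Re s > - 1 / real j \<and> s \<noteq> 0 \<longrightarrow>
              L s = R s \<and>
              s * L s = (\<integral>\<omega>. 1 / complex_of_real (kanter_a (1 - 1 / real j) (U \<omega>)) powr s \<partial>M) \<and>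
              s * R s = of_nat j * complex_of_real (kanter_const j) powr (s - 1)
                * (\<integral>\<omega>. complex_of_real (\<Prod>k\<in>{1..j-1}. \<beta> k \<omega>) powr (s - 1) \<partial>M))))"
proof -
  interpret prob_space M by fact
  note j = assms(2) and U = assms(3) and \<beta> = assms(4) and ind = assms(5)
  let ?W = "\<lambda>\<omega>. \<Prod>k\<in>{1..j-1}. \<beta> k \<omega>"
  let ?a = "\<lambda>\<omega>. kanter_a (1 - 1 / real j) (U \<omega>)"
  let ?D = "{s. Re s > - 1 / real j \<and> s \<noteq> 0}"
  define C where "C = kanter_const j"
  define X where "X \<omega> = kanter_recip j (U \<omega>)" for \<omega>
  define mX where "mX s = (\<integral>\<omega>. complex_of_real (X \<omega>) powr s \<partial>M)" for s
  define mW where "mW s = (\<integral>\<omega>. complex_of_real (?W \<omega>) powr (s - 1) \<partial>M)" for s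
  define T where "T s = (LINT u:{0<..}|lborel. tail_integrand M ?a s u)" for s
  have C: "C > 0" using j by (simp add: C_def kanter_const_def)
  have j0: "- 1 / real j < 0" using j by simp
  have [measurable]: "U \<in> borel_measurable M" using distributed_measurable[OF U] by simp
  have [measurable]: "X \<in> borel_measurable M" unfolding X_def by measurable
  have [measurable]: "kanter_a (1 - 1 / real j) \<in> borel_measurable borel"
    unfolding kanter_a_def[abs_def] kanter_b_def kanter_c_def by measurable
  have X: "AE \<omega> in M. 0 < X \<omega> \<and> X \<omega> \<le> C"
    using AE_kanter_recip[OF j U] by (simp add: X_def C_def)
  have a: "AE \<omega> in M. ?a \<omega> = 1 / X \<omega>"
    using AE_kanter_a[OF j U] by (simp add: X_def)
  have aX: "AE \<omega> in M. complex_of_real (X \<omega>) powr s = 1 / complex_of_real (?a \<omega>) powr s" for s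
    using X a
  proof eventually_elim
    case (elim \<omega>)
    hence "complex_of_real (?a \<omega>) powr s = exp (s * of_real (ln (1 / X \<omega>)))"
      by (subst of_real_powr_eq_exp) auto
    also have "\<dots> = 1 / complex_of_real (X \<omega>) powr s"
      using elim by (subst of_real_powr_eq_exp) (auto simp: ln_div exp_minus inverse_eq_divide)
    finally show ?case by simp
  qed
  have int_a: "integrable M (\<lambda>\<omega>. 1 / complex_of_real (?a \<omega>) powr s)" 
    and E_a: "(\<integral>\<omega>. 1 / complex_of_real (?a \<omega>) powr s \<partial>M) = mX s"
    and int_W: "integrable M (\<lambda>\<omega>. complex_of_real (?W \<omega>) powr (s - 1))"
    and mX_mW: "mX s = of_nat j * complex_of_real C powr (s - 1) * mW s"
    and int_X: "integrable M (\<lambda>\<omega>. complex_of_real (X \<omega>) powr s)"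
    if "Re s > - 1 / real j" for s
  proof -
    show 1: "integrable M (\<lambda>\<omega>. complex_of_real (X \<omega>) powr s)"
      using integrable_kanter_recip_powr[OF j U \<beta> ind that] by (simp add: X_def)
    thus "integrable M (\<lambda>\<omega>. 1 / complex_of_real (?a \<omega>) powr s)"
      by (rule Bochner_Integration.integrable_cong_AE_imp) (use aX[of s] in auto)
    show "(\<integral>\<omega>. 1 / complex_of_real (?a \<omega>) powr s \<partial>M) = mX s"
      unfolding mX_def using aX[of s] by (intro integral_cong_AE) auto
    show "integrable M (\<lambda>\<omega>. complex_of_real (?W \<omega>) powr (s - 1))"
      using integrable_prod_beta_powr[OF j U \<beta> ind that] .
    show "mX s = of_nat j * complex_of_real C powr (s - 1) * mW s"
      using integral_kanter_recip_powr[OF j U \<beta> ind that] by (simp only: mX_def mW_def C_def X_def)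
  qed
  \<comment> \<open>\<open>mX s\<close> is the integral of \<open>exp (s * ln (X \<omega>))\<close>,
    hence holomorphic on the whole half plane; division by \<open>s\<close> excludes only 0.\<close>
  have holo: "(\<lambda>s. mX s / s) holomorphic_on ?D"
  proof -
    have "(\<lambda>s. \<integral>\<omega>. exp (s * complex_of_real (ln (X \<omega>))) \<partial>M) holomorphic_on {s. - 1 / real j < Re s}"
    proof (rule holomorphic_on_integral_exp)
      fix \<sigma> assume "- 1 / real j < \<sigma>"
      hence "integrable M (\<lambda>\<omega>. norm (complex_of_real (X \<omega>) powr of_real \<sigma>))"
        by (intro integrable_norm int_X) simp
      thus "integrable M (\<lambda>\<omega>. exp (\<sigma> * ln (X \<omega>)))"
        by (rule Bochner_Integration.integrable_cong_AE_imp)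
           (use X in \<open>auto simp: norm_powr_real_powr powr_def\<close>)
    qed measurable
    moreover have "(\<integral>\<omega>. exp (s * complex_of_real (ln (X \<omega>))) \<partial>M) = mX s" for s
      unfolding mX_def using X by (intro integral_cong_AE) (auto simp: of_real_powr_eq_exp)
    ultimately have "mX holomorphic_on {s. - 1 / real j < Re s}" by simp
    hence "mX holomorphic_on ?D" by (rule holomorphic_on_subset) auto
    thus ?thesis by (intro holomorphic_intros) auto
  qed
  have sub: "{s. Re s > 0} \<subseteq> ?D"
  proof (intro subsetI CollectI conjI)
    fix s assume "s \<in> {s. Re s > 0}"
    hence "0 < Re s" by simp
    thus "- 1 / real j < Re s" "s \<noteq> 0" using j0 by (linarith, auto)
  qed
  have tail: "tail_integrand M ?a s u = of_real u powr (s - 1) * complex_of_real (prob {\<omega> \<in> space M. u < X \<omega>})"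
    if "u > 0" for s u
  proof -
    have "prob {\<omega> \<in> space M. ?a \<omega> < 1 / u} = prob {\<omega> \<in> space M. u < X \<omega>}"
    proof (rule finite_measure_eq_AE)
      show "AE \<omega> in M. (\<omega> \<in> {\<omega> \<in> space M. ?a \<omega> < 1 / u}) = (\<omega> \<in> {\<omega> \<in> space M. u < X \<omega>})"
        using X a
      proof eventually_elim
        case (elim \<omega>)
        hence "1 / X \<omega> < 1 / u \<longleftrightarrow> u < X \<omega>" using that by (auto simp: field_simps)
        thus ?case using elim by simp
      qed
    qed measurable
    thus ?thesis by (simp add: tail_integrand_def)
  qed
  have set_int_tail: "set_integrable lborel {0<..} (tail_integrand M ?a s) \<longleftrightarrow>
      set_integrable lborel {0<..} (\<lambda>u. of_real u powr (s - 1) * complex_of_real (prob {\<omega> \<in> space M. u < X \<omega>}))" for s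
    by (rule set_integrable_cong) (auto simp: tail)
  have T_eq: "T s = (LINT u:{0<..}|lborel. of_real u powr (s - 1) * complex_of_real (prob {\<omega> \<in> space M. u < X \<omega>}))" for s
    unfolding T_def by (rule set_lebesgue_integral_cong) (auto simp: tail)
  have Xpos: "AE \<omega> in M. X \<omega> > 0" using X by auto
  have int_tail: "set_integrable lborel {0<..} (tail_integrand M ?a s)"
    and T_pos: "T s = mX s / s" if s: "Re s > 0" for s
  proof -
    have "integrable M (\<lambda>\<omega>. norm (complex_of_real (X \<omega>) powr s))"
      using s j0 by (intro integrable_norm int_X) linarith
    hence "integrable M (\<lambda>\<omega>. X \<omega> powr Re s)"
      by (rule Bochner_Integration.integrable_cong_AE_imp) (use X in \<open>auto simp: norm_powr_real_powr\<close>)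
    from set_integrable_powr_tail[OF _ Xpos s this] LINT_powr_tail[OF _ Xpos s this]
    show "set_integrable lborel {0<..} (tail_integrand M ?a s)" "T s = mX s / s"
      unfolding set_int_tail T_eq mX_def by simp_all
  qed
  have T_zero: "T s = 0" if s: "Re s \<le> 0" for s
  proof -
    \<comment> \<open>Otherwise \<open>X \<le> 1/2\<close> almost surely, against
      \<open>expectation X = j\<close>. A positive tail at some level is what makes the tail
      integral diverge at 0.\<close>
    have "prob {\<omega> \<in> space M. 1/2 < X \<omega>} > 0"
    proof (rule ccontr)
      assume "\<not> prob {\<omega> \<in> space M. 1/2 < X \<omega>} > 0"
      hence "prob {\<omega> \<in> space M. 1/2 < X \<omega>} = 0" by (simp add: zero_less_measure_iff)
      hence "AE \<omega> in M. X \<omega> \<le> 1/2"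
        by (subst (asm) prob_eq_0) (auto simp: not_less)
      hence "expectation X \<le> expectation (\<lambda>_. 1/2)"
        using integrable_kanter_recip_power[OF j U, of 1] by (intro integral_mono_AE) (auto simp: X_def[abs_def])
      moreover have "expectation X = real j"
        using integral_kanter_recip_power[OF j U, of 1] by (simp add: X_def[abs_def])
      ultimately show False using j prob_space by simp
    qed
    from not_set_integrable_powr_tail[OF _ _ this s]
    \<comment> \<open>The Bochner integral of a non-integrable function is 0 by convention.\<close>
    show ?thesis unfolding T_eq set_integrable_def set_lebesgue_integral_def
      by (intro not_integrable_integral_eq) simp
  qed
  show ?thesis
  proof (intro conjI allI impI; (elim conjE)?)
    fix s assume s: "Re s > - 1 / real j"
    show "integrable M (\<lambda>\<omega>. 1 / complex_of_real (?a \<omega>) powr s)" by (rule int_a[OF s])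
    show "integrable M (\<lambda>\<omega>. complex_of_real (?W \<omega>) powr (s - 1))" by (rule int_W[OF s])
    show "(\<integral>\<omega>. 1 / complex_of_real (?a \<omega>) powr s \<partial>M)
          = of_nat j * complex_of_real (kanter_const j) powr (s - 1) * (\<integral>\<omega>. complex_of_real (?W \<omega>) powr (s - 1) \<partial>M)"
      unfolding E_a[OF s] mX_mW[OF s] by (simp only: C_def mW_def)
  next
    fix V assume V: "distributed M lborel V (\<lambda>x. ennreal (uniform_density 0 1 x))"
      and indV: "indep_vars (\<lambda>_. borel) (\<lambda>k. if k = 0 then V else \<beta> k) {0..j-1}"
    let ?R = "\<lambda>s. of_nat j * (\<integral>\<omega>. complex_of_real (kanter_const j * V \<omega> * ?W \<omega>) powr (s - 1) \<partial>M)"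
    have R_pos: "?R s = mX s / s" if s: "Re s > 0" for s
    proof -
      have "Re s > - 1 / real j" using s j0 by linarith
      from mX_mW[OF this] show ?thesis
        using integral_uniform_prod_beta_powr[OF j \<beta> V indV C s] by (simp add: mW_def C_def)
    qed
    {
      fix s :: complex assume s: "Re s > 0"
      show "set_integrable lborel {0<..} (tail_integrand M ?a s)" by (rule int_tail[OF s])
      show "integrable M (\<lambda>\<omega>. complex_of_real (kanter_const j * V \<omega> * ?W \<omega>) powr (s - 1))"
        using integrable_uniform_prod_beta_powr[OF j \<beta> V indV C s] by (simp only: C_def)
    next
      fix s assume "Re s > - 1 / real j" "s \<noteq> 0"
      \<comment> \<open>For \<open>Re s > 0\<close> both sides are \<open>mX s / s\<close>; for
        \<open>Re s \<le> 0\<close> both take the default value 0, and the analytic content there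
        lies in the continuations below.\<close>
      have "T s = ?R s"
      proof (cases "Re s > 0")
        case True
        thus ?thesis by (simp only: T_pos R_pos)
      next
        case False
        hence "(\<integral>\<omega>. complex_of_real (kanter_const j * V \<omega> * ?W \<omega>) powr (s - 1) \<partial>M) = 0"
          using not_integrable_uniform_prod_beta_powr[OF j \<beta> V indV C, of s]
          by (intro not_integrable_integral_eq) (simp add: C_def)
        thus ?thesis using False T_zero[of s] by simp
      qed
      thus "(LINT u:{0<..}|lborel. tail_integrand M ?a s u) = ?R s" by (simp only: T_def)
    next
      \<comment> \<open>The single function \<open>mX s / s\<close> continues both sides.
        Multiplying it by \<open>s\<close> returns \<open>mX s\<close>, to which the first identity
        applies on the full half plane.\<close>
      have "holomorphic_continuation (\<lambda>s. mX s / s) T {s. Re s > 0} ?D"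
        unfolding holomorphic_continuation_def using holo sub by (simp add: T_pos)
      moreover have "holomorphic_continuation (\<lambda>s. mX s / s) ?R {s. Re s > 0} ?D"
        unfolding holomorphic_continuation_def using holo sub R_pos by simp
      ultimately show "\<exists>L R.
           holomorphic_continuation L (\<lambda>s. LINT u:{0<..}|lborel. tail_integrand M ?a s u) {s. Re s > 0} ?D \<and>
           holomorphic_continuation R ?R {s. Re s > 0} ?D \<and>
           (\<forall>s. Re s > - 1 / real j \<and> s \<noteq> 0 \<longrightarrow>
              L s = R s \<and>
              s * L s = (\<integral>\<omega>. 1 / complex_of_real (?a \<omega>) powr s \<partial>M) \<and>
              s * R s = of_nat j * complex_of_real (kanter_const j) powr (s - 1)
                * (\<integral>\<omega>. complex_of_real (?W \<omega>) powr (s - 1) \<partial>M))"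
        unfolding T_def[abs_def] using E_a mX_mW unfolding mW_def C_def
        by (intro exI[of _ "\<lambda>s. mX s / s"] conjI) auto
    }
  qed
qed

end
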